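(* Let $\Gamma$ be an analytic Jordan curve (without cusps) bounding the simply connected domain $\Omega$, and let $\Pi=H+CHC$ acting on $\Lambda_\sigma(\Gamma)$. Then $\Pi$ admits a fixed point $F\in\Lambda_\sigma(\Gamma)$ that is not identically zero if and only if there exist non-constant $f\in A(\Gamma)$ and $g\in A'(\Gamma)$ with $f=\bar g$ on $\Gamma$. Moreover, if such $f$ and $g$ exist, then $\Pi f=f$ and $\Pi g=g$.
   Context: Fix $0<\sigma<1$. $\Omega$ is the interior domain of $\Gamma$ and $\Omega':=\widehat{\mathbb C}\setminus\overline\Omega$ the exterior domain (containing $\infty$). $\Lambda_\sigma(\Gamma)$ is the space of complex-valued Hölder continuous functions of order $\sigma$ on $\Gamma$. $A(\Gamma)$ is the set of restrictions to $\Gamma$ of functions that are $\sigma$-Hölder continuous on $\overline\Omega$ and holomorphic in $\Omega$; $A'(\Gamma)$ is the set of restrictions to $\Gamma$ of functions that are $\sigma$-Hölder continuous on $\overline{\Omega'}$, holomorphic in $\Omega'$, and vanish at $\infty$. The Hilbert operator $H:\Lambda_\sigma(\Gamma)\to\Lambda_\sigma(\Gamma)$ sends $F$ to the boundary values on $\Gamma$, taken from inside $\Omega$, of the Cauchy integral $f_i(z)=\frac{1}{2\pi i}\int_\Gamma \frac{F(\zeta)}{\zeta-z}\,d\zeta$, $z\in\Omega$; $H$ is a continuous idempotent with range $A(\Gamma)$ and kernel $A'(\Gamma)$. $C$ denotes complex conjugation, $CF=\overline F$. ($\Pi F$ equals the boundary values from $\Omega$ of the double layer potential $\frac1\pi\int_\Gamma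 F(\zeta)\,\partial_{N_\zeta}\log|z-\zeta|\,ds_\zeta$.) *)

theory Defs
  imports "HOL-Complex_Analysis.Complex_Analysis"
begin

definition analytic_jordan_curve :: "(real \<Rightarrow> complex) \<Rightarrow> bool" where
  "analytic_jordan_curve \<gamma> \<longleftrightarrow>
     (\<exists>G S. open S \<and> (\<forall>t::real. complex_of_real t \<in> S) \<and> G holomorphic_on S \<and>
            (\<forall>t::real. \<gamma> t = G (complex_of_real t)) \<and>
            (\<forall>t::real. deriv G (complex_of_real t) \<noteq> 0)) \<and>
     (\<forall>t. \<gamma> (t + 1) = \<gamma> t) \<and> inj_on \<gamma> {0..<1}"

definition holder_on :: "real \<Rightarrow> complex set \<Rightarrow> (complex \<Rightarrow> complex) \<Rightarrow> bool" where
  "holder_on \<sigma> S f \<longleftrightarrow> (\<exists>M. \<forall>x\<in>S. \<forall>y\<in>S. norm (f x - f y) \<le> M * dist x y powr \<sigma>)"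

text \<open>\<Lambda>_\<sigma>(\<Gamma>): functions on \<Gamma> (represented as functions on complex; only
  values on \<Gamma> matter) that are \<sigma>-Hoelder on \<Gamma>.\<close>
definition Lambda_sigma :: "real \<Rightarrow> complex set \<Rightarrow> (complex \<Rightarrow> complex) set" where
  "Lambda_sigma \<sigma> \<Gamma> = {F. holder_on \<sigma> \<Gamma> F}"

definition A_space :: "real \<Rightarrow> complex set \<Rightarrow> (complex \<Rightarrow> complex) set" where
  "A_space \<sigma> \<Gamma> = {F. \<exists>f. holder_on \<sigma> (closure (inside \<Gamma>)) f \<and> f holomorphic_on inside \<Gamma> \<and>
                          (\<forall>z\<in>\<Gamma>. F z = f z)}"

definition A'_space :: "real \<Rightarrow> complex set \<Rightarrow> (complex \<Rightarrow> complex) set" where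
  "A'_space \<sigma> \<Gamma> = {F. \<exists>g. holder_on \<sigma> (closure (outside \<Gamma>)) g \<and> g holomorphic_on outside \<Gamma> \<and>
                          (g \<longlongrightarrow> 0) at_infinity \<and> (\<forall>z\<in>\<Gamma>. F z = g z)}"

definition cauchy_int :: "(real \<Rightarrow> complex) \<Rightarrow> (complex \<Rightarrow> complex) \<Rightarrow> complex \<Rightarrow> complex" where
  "cauchy_int \<gamma> F z = contour_integral \<gamma> (\<lambda>\<zeta>. F \<zeta> / (\<zeta> - z)) / (2 * pi * \<i>)"

definition hilbert_op :: "(real \<Rightarrow> complex) \<Rightarrow> (complex \<Rightarrow> complex) \<Rightarrow> complex \<Rightarrow> complex" where
  "hilbert_op \<gamma> F z0 = Lim (at z0 within inside (path_image \<gamma>)) (cauchy_int \<gamma> F)"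

definition conj_op :: "(complex \<Rightarrow> complex) \<Rightarrow> complex \<Rightarrow> complex" where
  "conj_op F = (\<lambda>z. cnj (F z))"

definition Pi_op :: "(real \<Rightarrow> complex) \<Rightarrow> (complex \<Rightarrow> complex) \<Rightarrow> complex \<Rightarrow> complex" where
  "Pi_op \<gamma> F = (\<lambda>z. hilbert_op \<gamma> F z + conj_op (hilbert_op \<gamma> (conj_op F)) z)"

end

theory Submission
  imports Defs
begin

text \<open>
  For a Hoelder density \<open>F\<close> the Cauchy integral extends to Hoelder functions \<open>u\<close>, \<open>v\<close> on the closed interior
  and exterior, with \<open>u - v = F\<close> on the curve (Plemelj-Privalov). Both boundary functions are
  expressed by the absolutely convergent integral of \<open>(F \<zeta> - F a) / (\<zeta> - a)\<close>, and every estimate comes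
  down to \<open>\<integral> \<bar>\<zeta> - a\<bar> powr (\<sigma> - 1) * d / (\<bar>\<zeta> - a\<bar> + d) \<le> C * d powr \<sigma>\<close>, which scaling by \<open>d\<close>
  reduces to the integrability of \<open>x powr (\<sigma> - 1) / (x + 1)\<close>.

  An analytic arc is removable for continuous functions, so a function continuous on the plane,
  holomorphic off the curve and vanishing at infinity is zero by Liouville. Hence
  \<open>A(\<Gamma>) \<inter> A'(\<Gamma>) = 0\<close> and \<open>\<Lambda>\<^sub>\<sigma>(\<Gamma>) = A(\<Gamma>) \<oplus> A'(\<Gamma>)\<close> with \<open>H\<close> the projection onto \<open>A(\<Gamma>)\<close>; no Cauchy theorem
  up to the boundary is needed. If \<open>\<Pi> F = F\<close> then \<open>F - H F = C H C F\<close>, so that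
  \<open>C H F\<close> and \<open>C H C F\<close> lie in \<open>A'(\<Gamma>)\<close>, and whichever of \<open>H F\<close>, \<open>H C F\<close> is nonzero is the required \<open>f\<close>.
\<close>

subsection \<open>Hoelder functions\<close>

lemma holder_on_altdef:
  "holder_on \<sigma> S f \<longleftrightarrow> (\<exists>M\<ge>0. \<forall>x\<in>S. \<forall>y\<in>S. norm (f x - f y) \<le> M * dist x y powr \<sigma>)"
proof
  assume "holder_on \<sigma> S f"
  then obtain M where M: "\<And>x y. x \<in> S \<Longrightarrow> y \<in> S \<Longrightarrow> norm (f x - f y) \<le> M * dist x y powr \<sigma>"
    unfolding holder_on_def by blast
  have "norm (f x - f y) \<le> \<bar>M\<bar> * dist x y powr \<sigma>" if "x \<in> S" "y \<in> S" for x y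
    using M[OF that] mult_right_mono[OF abs_ge_self[of M], of "dist x y powr \<sigma>"] by simp
  then show "\<exists>M\<ge>0. \<forall>x\<in>S. \<forall>y\<in>S. norm (f x - f y) \<le> M * dist x y powr \<sigma>"
    by (intro exI[of _ "\<bar>M\<bar>"]) simp
qed (auto simp: holder_on_def)

lemma holder_on_subset: "holder_on \<sigma> S f \<Longrightarrow> T \<subseteq> S \<Longrightarrow> holder_on \<sigma> T f"
  unfolding holder_on_def by blast

lemma holder_on_cong: "(\<And>z. z \<in> S \<Longrightarrow> f z = g z) \<Longrightarrow> holder_on \<sigma> S f \<longleftrightarrow> holder_on \<sigma> S g"
  unfolding holder_on_def by simp

lemma holder_on_const: "holder_on \<sigma> S (\<lambda>z. c)"
  unfolding holder_on_def by (auto intro: exI[of _ 0])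

lemma holder_on_cnj: "holder_on \<sigma> S f \<Longrightarrow> holder_on \<sigma> S (\<lambda>z. cnj (f z))"
  unfolding holder_on_def by (simp flip: complex_cnj_diff)

lemma holder_on_cmult:
  assumes "holder_on \<sigma> S f"
  shows "holder_on \<sigma> S (\<lambda>z. c * f z)"
proof -
  obtain M where M: "\<And>x y. x \<in> S \<Longrightarrow> y \<in> S \<Longrightarrow> norm (f x - f y) \<le> M * dist x y powr \<sigma>"
    using assms unfolding holder_on_def by blast
  have "norm (c * f x - c * f y) \<le> (norm c * M) * dist x y powr \<sigma>" if "x \<in> S" "y \<in> S" for x y
    using mult_left_mono[OF M[OF that] norm_ge_zero[of c]]
    by (simp add: norm_mult mult.assoc flip: right_diff_distrib)
  then show ?thesis unfolding holder_on_def by blast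
qed

lemma holder_on_add:
  assumes "holder_on \<sigma> S f" "holder_on \<sigma> S g"
  shows "holder_on \<sigma> S (\<lambda>z. f z + g z)"
proof -
  obtain M where M: "\<And>x y. x \<in> S \<Longrightarrow> y \<in> S \<Longrightarrow> norm (f x - f y) \<le> M * dist x y powr \<sigma>"
    using assms(1) unfolding holder_on_def by blast
  obtain N where N: "\<And>x y. x \<in> S \<Longrightarrow> y \<in> S \<Longrightarrow> norm (g x - g y) \<le> N * dist x y powr \<sigma>"
    using assms(2) unfolding holder_on_def by blast
  have "norm (f x + g x - (f y + g y)) \<le> (M + N) * dist x y powr \<sigma>" if "x \<in> S" "y \<in> S" for x y
    using norm_diff_triangle_ineq[of "f x" "g x" "f y" "g y"] M[OF that] N[OF that]
    by (simp add: distrib_right)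
  then show ?thesis unfolding holder_on_def by blast
qed

lemma holder_on_uminus: "holder_on \<sigma> S f \<Longrightarrow> holder_on \<sigma> S (\<lambda>z. - f z)"
  using holder_on_cmult[of \<sigma> S f "-1"] by simp

lemma holder_on_diff:
  "holder_on \<sigma> S f \<Longrightarrow> holder_on \<sigma> S g \<Longrightarrow> holder_on \<sigma> S (\<lambda>z. f z - g z)"
  using holder_on_add[OF _ holder_on_uminus, of \<sigma> S f g] by simp

lemma holder_on_imp_continuous_on:
  assumes "holder_on \<sigma> S f" "0 < \<sigma>"
  shows "continuous_on S f"
  unfolding continuous_on_def
proof
  obtain M where M: "\<And>x y. x \<in> S \<Longrightarrow> y \<in> S \<Longrightarrow> norm (f x - f y) \<le> M * dist x y powr \<sigma>"
    using assms(1) unfolding holder_on_def by blast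
  fix x assume x: "x \<in> S"
  have "((\<lambda>y. M * dist y x powr \<sigma>) \<longlongrightarrow> M * dist x x powr \<sigma>) (at x within S)"
    using assms by (intro tendsto_intros tendsto_powr') (auto intro: eventuallyI)
  then have "((\<lambda>y. M * dist y x powr \<sigma>) \<longlongrightarrow> 0) (at x within S)" using assms by simp
  moreover have "\<forall>\<^sub>F y in at x within S. norm (f y - f x) \<le> M * dist y x powr \<sigma>"
    using M x by (auto simp: eventually_at_filter)
  ultimately have "((\<lambda>y. f y - f x) \<longlongrightarrow> 0) (at x within S)"
    by (rule Lim_null_comparison[rotated])
  then show "(f \<longlongrightarrow> f x) (at x within S)" by (rule LIM_zero_cancel)
qed

lemma holder_bound_via_nearby_points:
  fixes f :: "'a :: metric_space \<Rightarrow> 'b :: real_normed_vector"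
  assumes "0 \<le> \<sigma>" "0 \<le> A" "0 \<le> M"
    and "norm (f z - f a) \<le> A * dist z a powr \<sigma>" "norm (f w - f b) \<le> A * dist w b powr \<sigma>"
    and "norm (f a - f b) \<le> M * dist a b powr \<sigma>"
    and near: "dist z a \<le> 2 * dist z w" "dist w b \<le> 2 * dist z w"
  shows "norm (f z - f w) \<le> (2 * (A * 2 powr \<sigma>) + M * 5 powr \<sigma>) * dist z w powr \<sigma>"
proof -
  define \<delta> where "\<delta> = dist z w powr \<sigma>"
  have "dist a b \<le> 5 * dist z w"
    using near dist_triangle[of a b z] dist_triangle[of z b w] by (simp add: dist_commute)
  then have \<delta>: "dist z a powr \<sigma> \<le> 2 powr \<sigma> * \<delta>" "dist w b powr \<sigma> \<le> 2 powr \<sigma> * \<delta>" "dist a b powr \<sigma> \<le> 5 powr \<sigma> * \<delta>"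
    using near assms(1) by (auto simp: \<delta>_def powr_mono2 simp flip: powr_mult)
  have "norm (f z - f w) \<le> norm (f z - f a) + norm (f w - f b) + norm (f a - f b)" by norm
  also have "\<dots> \<le> A * dist z a powr \<sigma> + A * dist w b powr \<sigma> + M * dist a b powr \<sigma>"
    by (intro add_mono assms(4-6))
  also have "\<dots> \<le> A * (2 powr \<sigma> * \<delta>) + A * (2 powr \<sigma> * \<delta>) + M * (5 powr \<sigma> * \<delta>)"
    using assms(2,3) by (intro add_mono mult_left_mono \<delta>)
  finally show ?thesis by (simp add: \<delta>_def algebra_simps)
qed

text \<open>
  Two points that are close relative to their distance from \<open>K\<close> are compared directly, all others
  through their nearest points in \<open>K\<close>.
\<close>

lemma holder_on_Un_closed:
  assumes K: "closed K" "K \<noteq> {}" and \<sigma>: "0 \<le> \<sigma>" and f: "holder_on \<sigma> K f"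
    and A: "0 \<le> A" "\<And>z a. z \<in> \<Omega> \<Longrightarrow> a \<in> K \<Longrightarrow> infdist z K = dist z a \<Longrightarrow> norm (f z - f a) \<le> A * dist z a powr \<sigma>"
    and B: "0 \<le> B" "\<And>z w. z \<in> \<Omega> \<Longrightarrow> w \<in> \<Omega> \<Longrightarrow> 2 * dist z w \<le> infdist z K \<Longrightarrow> norm (f z - f w) \<le> B * dist z w powr \<sigma>"
  shows "holder_on \<sigma> (\<Omega> \<union> K) f"
proof -
  obtain M where M: "0 \<le> M" "\<And>x y. x \<in> K \<Longrightarrow> y \<in> K \<Longrightarrow> norm (f x - f y) \<le> M * dist x y powr \<sigma>"
    using f unfolding holder_on_altdef by blast
  define C where "C = B + 2 * (A * 2 powr \<sigma>) + M * 5 powr \<sigma>"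
  have nearest: "\<exists>a\<in>K. dist z a = infdist z K \<and> norm (f z - f a) \<le> A * dist z a powr \<sigma>"
    if "z \<in> \<Omega> \<union> K" for z
  proof (cases "z \<in> K")
    case False
    then show ?thesis using A(2)[of z] that infdist_attains_inf[OF K, of z] by (metis UnE)
  qed (auto intro!: bexI[of _ z])
  have far: "norm (f z - f w) \<le> C * dist z w powr \<sigma>"
    if z: "z \<in> \<Omega> \<union> K" and w: "w \<in> \<Omega> \<union> K" and zw: "z \<noteq> w" "2 * dist z w \<le> infdist z K" for z w
  proof -
    have "z \<notin> K" using zw by auto
    moreover have "w \<notin> K"
      using infdist_le[of w K z] zw zero_less_dist_iff[of z w] by force
    ultimately have "norm (f z - f w) \<le> B * dist z w powr \<sigma>" using z w zw B(2) by blast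
    also have "\<dots> \<le> C * dist z w powr \<sigma>"
      using A(1) M(1) by (intro mult_right_mono) (auto simp: C_def)
    finally show ?thesis .
  qed
  have near: "norm (f z - f w) \<le> C * dist z w powr \<sigma>"
    if z: "z \<in> \<Omega> \<union> K" "infdist z K \<le> 2 * dist z w" and w: "w \<in> \<Omega> \<union> K" "infdist w K \<le> 2 * dist z w" for z w
  proof -
    obtain a where a: "a \<in> K" "dist z a = infdist z K" "norm (f z - f a) \<le> A * dist z a powr \<sigma>"
      using nearest[OF z(1)] by blast
    obtain b where b: "b \<in> K" "dist w b = infdist w K" "norm (f w - f b) \<le> A * dist w b powr \<sigma>"
      using nearest[OF w(1)] by blast
    have "norm (f z - f w) \<le> (2 * (A * 2 powr \<sigma>) + M * 5 powr \<sigma>) * dist z w powr \<sigma>"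
      by (rule holder_bound_via_nearby_points[OF \<sigma> A(1) M(1) a(3) b(3) M(2)[OF a(1) b(1)]])
         (simp_all add: a(2) b(2) z(2) w(2))
    also have "\<dots> \<le> C * dist z w powr \<sigma>" using B(1) by (intro mult_right_mono) (auto simp: C_def)
    finally show ?thesis .
  qed
  have "norm (f z - f w) \<le> C * dist z w powr \<sigma>" if "z \<in> \<Omega> \<union> K" "w \<in> \<Omega> \<union> K" for z w
    using far[OF that] far[OF that(2,1)] near[OF that(1) _ that(2)]
    by (cases "z = w"; simp add: dist_commute norm_minus_commute) linarith
  then show ?thesis unfolding holder_on_def by blast
qed

subsection \<open>The weakly singular kernel\<close>

definition weak_kernel :: "real \<Rightarrow> real \<Rightarrow> real \<Rightarrow> real" where
  "weak_kernel \<sigma> d u = u powr (\<sigma> - 1) * d / (u + d)"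

lemma weak_kernel_0 [simp]: "weak_kernel \<sigma> d 0 = 0"
  by (simp add: weak_kernel_def)

lemma weak_kernel_nonneg: "0 \<le> d \<Longrightarrow> 0 \<le> u \<Longrightarrow> 0 \<le> weak_kernel \<sigma> d u"
  by (simp add: weak_kernel_def)

lemma weak_kernel_antimono:
  assumes "\<sigma> \<le> 1" "0 < d" "0 < v" "v \<le> u"
  shows "weak_kernel \<sigma> d u \<le> weak_kernel \<sigma> d v"
  unfolding weak_kernel_def using assms by (intro frac_le mult_right_mono powr_mono2') auto

lemma weak_kernel_measurable [measurable]: "weak_kernel \<sigma> d \<in> borel_measurable borel"
  unfolding weak_kernel_def by measurable

lemma integrable_weak_kernel:
  assumes "0 < \<sigma>" "\<sigma> < 1"
  shows "integrable lborel (\<lambda>x. weak_kernel \<sigma> 1 \<bar>x\<bar>)"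
proof -
  have dominated: "weak_kernel \<sigma> 1 absolutely_integrable_on S"
    if "((\<lambda>x. x powr e) has_integral I) S"
      "\<And>x. x \<in> S \<Longrightarrow> 0 \<le> x \<and> weak_kernel \<sigma> 1 x \<le> x powr e" "S \<in> sets borel" for S e I
  proof (rule set_integrable_bound)
    show "(\<lambda>x. x powr e) absolutely_integrable_on S"
      using that(1) by (intro nonnegative_absolutely_integrable_1) auto
    show "set_borel_measurable lebesgue S (weak_kernel \<sigma> 1)"
      unfolding set_borel_measurable_def using that(3)
      by (intro measurable_completion borel_measurable_scaleR) (simp_all add: weak_kernel_measurable)
  qed (use that(2) in \<open>auto simp: weak_kernel_nonneg\<close>)
  have "weak_kernel \<sigma> 1 absolutely_integrable_on {0..1}"
    using assms by (intro dominated[OF has_integral_powr_from_0[of "\<sigma> - 1"]])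
      (auto simp: weak_kernel_def divide_le_eq mult_le_cancel_left1)
  moreover have "weak_kernel \<sigma> 1 absolutely_integrable_on {1..}"
  proof (intro dominated[OF has_integral_powr_to_inf[of "\<sigma> - 2"]])
    fix x :: real assume "x \<in> {1..}"
    then have "x powr (\<sigma> - 1) / (x + 1) \<le> x powr (\<sigma> - 1) / x" by (intro divide_left_mono) auto
    also have "\<dots> = x powr (\<sigma> - 2)" using \<open>x \<in> {1..}\<close> by (simp add: powr_diff power2_eq_square)
    finally show "0 \<le> x \<and> weak_kernel \<sigma> 1 x \<le> x powr (\<sigma> - 2)"
      using \<open>x \<in> {1..}\<close> by (simp add: weak_kernel_def)
  qed (use assms in auto)
  ultimately have "weak_kernel \<sigma> 1 absolutely_integrable_on {0..1} \<union> {1..}"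
    by (intro set_integrable_Un) auto
  moreover have "{0..1} \<union> {1..} = {0::real..}" by auto
  ultimately have half: "integrable lborel (\<lambda>x. indicator {0..} x *\<^sub>R weak_kernel \<sigma> 1 x)"
    unfolding set_integrable_def by (simp add: integrable_completion)
  have "integrable lborel
      (\<lambda>x. indicator {0..} x *\<^sub>R weak_kernel \<sigma> 1 x + indicator {0..} (- x) *\<^sub>R weak_kernel \<sigma> 1 (- x))"
    using half lborel_integrable_real_affine[OF half, of "-1" 0]
    by (intro Bochner_Integration.integrable_add) auto
  moreover have "indicator {0..} x *\<^sub>R weak_kernel \<sigma> 1 x + indicator {0..} (- x) *\<^sub>R weak_kernel \<sigma> 1 (- x)
      = weak_kernel \<sigma> 1 \<bar>x\<bar>" for x
    by (cases "x = 0") (auto simp: abs_if)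
  ultimately show ?thesis by simp
qed

definition weak_mass :: "real \<Rightarrow> real" where
  "weak_mass \<sigma> = (\<integral>x. weak_kernel \<sigma> 1 \<bar>x\<bar> \<partial>lborel)"

lemma weak_mass_nonneg: "0 \<le> weak_mass \<sigma>"
  by (simp add: weak_mass_def weak_kernel_nonneg)

lemma weak_kernel_scale:
  assumes "0 < d" "0 \<le> u"
  shows "weak_kernel \<sigma> d u = d powr (\<sigma> - 1) * weak_kernel \<sigma> 1 (u / d)"
proof -
  have "u / d + 1 = (u + d) / d" using assms by (simp add: field_simps)
  then show ?thesis using assms by (simp add: weak_kernel_def powr_divide)
qed

lemma
  assumes "0 < \<sigma>" "\<sigma> < 1" "0 < d" "0 < c"
  shows integrable_weak_kernel_affine: "integrable lborel (\<lambda>t. weak_kernel \<sigma> d (c * \<bar>t - p\<bar>))"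
    and integral_weak_kernel_affine:
      "(\<integral>t. weak_kernel \<sigma> d (c * \<bar>t - p\<bar>) \<partial>lborel) = weak_mass \<sigma> / c * d powr \<sigma>"
proof -
  have scale: "weak_kernel \<sigma> d (c * \<bar>t - p\<bar>) = d powr (\<sigma> - 1) * weak_kernel \<sigma> 1 \<bar>- (c / d * p) + c / d * t\<bar>" for t
  proof -
    have "c * \<bar>t - p\<bar> / d = \<bar>c / d * (t - p)\<bar>" using assms by (simp add: abs_mult)
    also have "c / d * (t - p) = - (c / d * p) + c / d * t" by (simp add: diff_divide_distrib right_diff_distrib)
    finally show ?thesis using weak_kernel_scale[of d "c * \<bar>t - p\<bar>" \<sigma>] assms by simp
  qed
  have "c / d \<noteq> 0" using assms by simp
  then show "integrable lborel (\<lambda>t. weak_kernel \<sigma> d (c * \<bar>t - p\<bar>))"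
    unfolding scale using integrable_weak_kernel[OF assms(1,2)]
    by (intro Bochner_Integration.integrable_mult_right
          lborel_integrable_real_affine[where f="\<lambda>x. weak_kernel \<sigma> 1 \<bar>x\<bar>"])
  show "(\<integral>t. weak_kernel \<sigma> d (c * \<bar>t - p\<bar>) \<partial>lborel) = weak_mass \<sigma> / c * d powr \<sigma>"
    unfolding scale weak_mass_def
      lborel_integral_real_affine[OF \<open>c / d \<noteq> 0\<close>, of "\<lambda>x. weak_kernel \<sigma> 1 \<bar>x\<bar>" "- (c / d * p)"]
    using assms by (simp add: powr_diff)
qed

lemma mult_powr_le_powr:
  fixes \<delta> :: real
  assumes "\<sigma> \<le> 1" "0 \<le> \<delta>" "\<delta> \<le> d"
  shows "\<delta> * d powr (\<sigma> - 1) \<le> \<delta> powr \<sigma>"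
proof (cases "\<delta> = 0")
  case False
  then have "\<delta> * d powr (\<sigma> - 1) \<le> \<delta> * \<delta> powr (\<sigma> - 1)"
    using assms by (intro mult_left_mono powr_mono2') auto
  also have "\<dots> = \<delta> powr \<sigma>" using assms(2) by (simp add: powr_mult_base)
  finally show ?thesis .
qed simp

text \<open>
  For a curve of period 1, parameters \<open>t\<close> and \<open>p\<close> in \<open>[0, 1]\<close> are at distance at most \<open>1/2\<close> only up to one of
  these shifts.
\<close>

definition weak_majorant :: "real \<Rightarrow> real \<Rightarrow> real \<Rightarrow> real \<Rightarrow> real \<Rightarrow> real" where
  "weak_majorant \<sigma> d c p t = (\<Sum>k\<in>{-1, 0, 1}. weak_kernel \<sigma> d (c * \<bar>t - (p + of_int k)\<bar>))"

lemma weak_kernel_le_majorant: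
  assumes "k \<in> {-1, 0, 1}" "0 \<le> d" "0 \<le> c"
  shows "weak_kernel \<sigma> d (c * \<bar>t - (p + of_int k)\<bar>) \<le> weak_majorant \<sigma> d c p t"
  unfolding weak_majorant_def using assms by (intro member_le_sum[of k] weak_kernel_nonneg) auto

lemma weak_majorant_integral:
  assumes \<sigma>: "0 < \<sigma>" "\<sigma> < 1" and d: "0 < d" and c: "0 < c"
  shows "weak_majorant \<sigma> d c p integrable_on {0..1}"
    and "integral {0..1} (weak_majorant \<sigma> d c p) \<le> 3 * (weak_mass \<sigma> / c) * d powr \<sigma>"
proof -
  have "integrable lborel (weak_majorant \<sigma> d c p)"
    unfolding weak_majorant_def by (intro Bochner_Integration.integrable_sum integrable_weak_kernel_affine \<sigma> d c)
  then have has_integral: "(weak_majorant \<sigma> d c p has_integral integral\<^sup>L lborel (weak_majorant \<sigma> d c p)) UNIV"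
    by (rule has_integral_integral_lborel)
  then show int: "weak_majorant \<sigma> d c p integrable_on {0..1}"
    by (intro integrable_on_subinterval[OF has_integral_integrable]) auto
  have "0 \<le> weak_majorant \<sigma> d c p t" for t
    unfolding weak_majorant_def using c d by (intro sum_nonneg weak_kernel_nonneg) auto
  then have "integral {0..1} (weak_majorant \<sigma> d c p) \<le> integral UNIV (weak_majorant \<sigma> d c p)"
    using int has_integral by (intro integral_subset_le) auto
  also have "\<dots> = integral\<^sup>L lborel (weak_majorant \<sigma> d c p)"
    using has_integral by (rule integral_unique)
  also have "\<dots> = 3 * (weak_mass \<sigma> / c) * d powr \<sigma>"
    unfolding weak_majorant_def
    by (subst Bochner_Integration.integral_sum)
       (simp_all add: integrable_weak_kernel_affine integral_weak_kernel_affine \<sigma> d c)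
  finally show "integral {0..1} (weak_majorant \<sigma> d c p) \<le> 3 * (weak_mass \<sigma> / c) * d powr \<sigma>" .
qed

subsection \<open>Regular Jordan curves\<close>

locale regular_jordan_curve =
  fixes \<gamma> :: "real \<Rightarrow> complex"
  assumes differentiable: "\<gamma> differentiable at t"
    and continuous_on_velocity: "continuous_on UNIV (\<lambda>t. vector_derivative \<gamma> (at t))"
    and velocity_nonzero: "vector_derivative \<gamma> (at t) \<noteq> 0"
    and periodic: "\<gamma> (t + 1) = \<gamma> t"
    and inj: "inj_on \<gamma> {0..<1}"
begin

abbreviation \<Gamma> :: "complex set" where "\<Gamma> \<equiv> path_image \<gamma>"

abbreviation velocity :: "real \<Rightarrow> complex" where "velocity t \<equiv> vector_derivative \<gamma> (at t)"

sublocale curve: periodic_fun_simple' \<gamma>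
  by unfold_locales (rule periodic)

lemma has_velocity: "(\<gamma> has_vector_derivative velocity t) (at t)"
  using differentiable by (simp add: vector_derivative_works)

lemma continuous_curve: "continuous_on S \<gamma>"
  by (meson differentiable continuous_at_imp_continuous_on differentiable_imp_continuous_within)

lemma continuous_velocity: "continuous_on S velocity"
  using continuous_on_velocity continuous_on_subset by blast

lemma curve_frac: "\<gamma> (frac t) = \<gamma> t"
  using curve.minus_of_int[of t "\<lfloor>t\<rfloor>"] by (simp add: frac_def)

lemma curve_eq_imp_integer_shift:
  assumes "\<gamma> s = \<gamma> t"
  shows "s - t \<in> \<int>"
proof -
  have "frac s = frac t"
    using assms inj curve_frac by (metis atLeastLessThan_iff frac_ge_0 frac_lt_1 inj_onD)
  then have "s - t = of_int (\<lfloor>s\<rfloor> - \<lfloor>t\<rfloor>)" by (simp add: frac_def)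
  then show ?thesis by simp
qed

lemma curve_in_path_image [simp]: "\<gamma> t \<in> \<Gamma>"
  unfolding path_image_def
  by (rule image_eqI[of _ _ "frac t"]) (auto simp: curve_frac frac_ge_0 frac_lt_1 less_imp_le)

lemma path_imageE:
  assumes "a \<in> \<Gamma>"
  obtains s where "s \<in> {0..1}" "a = \<gamma> s"
  using assms by (auto simp: path_image_def)

lemma simple_path_curve: "simple_path \<gamma>"
proof (rule simple_pathI)
  show "path \<gamma>" by (simp add: path_def continuous_curve)
  fix x y :: real assume xy: "0 \<le> x" "x < y" "y \<le> 1" "\<gamma> x = \<gamma> y"
  have "y - x \<in> \<int>" using curve_eq_imp_integer_shift xy(4) by metis
  then have "1 \<le> y - x" using Ints_nonzero_abs_ge1[of "y - x"] xy(2) by simp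
  then show "x = 0 \<and> y = 1" using xy by linarith
qed

lemma closed_curve: "pathfinish \<gamma> = pathstart \<gamma>"
  using periodic[of 0] by (simp add: pathfinish_def pathstart_def)

lemma valid_path_curve: "valid_path \<gamma>"
proof -
  have "\<gamma> C1_differentiable_on {0..1}"
    unfolding C1_differentiable_on_def using has_velocity continuous_velocity
    by (intro exI[of _ velocity]) auto
  then show ?thesis by (simp add: valid_path_def C1_differentiable_imp_piecewise)
qed

lemmas closed_path_image_curve = closed_simple_path_image[OF simple_path_curve]

lemma jordan:
  "closure (inside \<Gamma>) = inside \<Gamma> \<union> \<Gamma>"
  "closure (outside \<Gamma>) = outside \<Gamma> \<union> \<Gamma>"
  "open (inside \<Gamma>)" "open (outside \<Gamma>)"
  "bounded (inside \<Gamma>)"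
  using Jordan_inside_outside[OF simple_path_curve closed_curve]
  by (auto simp: closure_Un_frontier)

lemma not_in_path_image: "z \<in> inside \<Gamma> \<Longrightarrow> z \<notin> \<Gamma>" "z \<in> outside \<Gamma> \<Longrightarrow> z \<notin> \<Gamma>"
  using inside_no_overlap outside_no_overlap by blast+

lemma winding_number_outside: "z \<in> outside \<Gamma> \<Longrightarrow> winding_number \<gamma> z = 0"
  using winding_number_zero_in_outside simple_path_curve closed_curve simple_path_imp_path by blast

lemma continuous_speed: "continuous_on S (\<lambda>t. norm (velocity t))"
  by (intro continuous_intros continuous_velocity)

lemma speed_bounded_below:
  obtains m where "0 < m" "\<And>t. t \<in> {0..1} \<Longrightarrow> m \<le> norm (velocity t)"
proof -
  obtain x where "\<forall>t\<in>{0..1}. norm (velocity x) \<le> norm (velocity t)"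
    using continuous_attains_inf[OF _ _ continuous_speed, of "{0..1}"] by auto
  then show thesis using that[of "norm (velocity x)"] velocity_nonzero[of x] by simp
qed

lemma speed_bounded:
  obtains L where "0 \<le> L" "\<And>t. t \<in> {0..1} \<Longrightarrow> norm (velocity t) \<le> L"
proof -
  obtain x where "\<forall>t\<in>{0..1}. norm (velocity t) \<le> norm (velocity x)"
    using continuous_attains_sup[OF _ _ continuous_speed, of "{0..1}"] by auto
  then show thesis using that[of "norm (velocity x)"] by simp
qed

definition mean_velocity :: "real \<Rightarrow> real \<Rightarrow> complex" where
  "mean_velocity s h = integral {0..1} (\<lambda>\<tau>. velocity (s + \<tau> * h))"

lemma mean_velocity_0 [simp]: "mean_velocity s 0 = velocity s"
  by (simp add: mean_velocity_def)

lemma scaleR_mean_velocity: "h *\<^sub>R mean_velocity s h = \<gamma> (s + h) - \<gamma> s"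
proof -
  have "((\<lambda>\<tau>. h *\<^sub>R velocity (s + \<tau> * h)) has_integral \<gamma> (s + 1 * h) - \<gamma> (s + 0 * h)) {0..1}"
  proof (rule fundamental_theorem_of_calculus)
    fix \<tau> :: real
    have "((\<lambda>\<tau>. s + \<tau> * h) has_vector_derivative h) (at \<tau> within {0..1})"
      by (auto intro!: derivative_eq_intros)
    from vector_diff_chain_within[OF this has_vector_derivative_at_within[OF has_velocity]]
    show "((\<lambda>\<tau>. \<gamma> (s + \<tau> * h)) has_vector_derivative h *\<^sub>R velocity (s + \<tau> * h)) (at \<tau> within {0..1})"
      by (simp add: o_def)
  qed simp
  then show ?thesis by (simp add: mean_velocity_def integral_unique flip: integral_cmul)
qed

lemma continuous_mean_velocity: "continuous_on S (\<lambda>(s, h). mean_velocity s h)"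
proof -
  have "continuous_on (S \<times> cbox 0 1) (\<lambda>(p, \<tau>). velocity (fst p + \<tau> * snd p))"
    unfolding split_beta by (intro continuous_on_compose2[OF continuous_on_velocity] continuous_intros) auto
  from integral_continuous_on_param[OF this] show ?thesis
    by (simp add: mean_velocity_def split_beta)
qed

lemma chord_arc:
  obtains c where "0 < c" "\<And>s t. s \<in> {0..1} \<Longrightarrow> \<bar>t - s\<bar> \<le> 1/2 \<Longrightarrow> c * \<bar>t - s\<bar> \<le> norm (\<gamma> t - \<gamma> s)"
proof -
  have nonzero: "mean_velocity s h \<noteq> 0" if "\<bar>h\<bar> \<le> 1/2" for s h
  proof (cases "h = 0")
    case False
    then have "h \<notin> \<int>" using that Ints_nonzero_abs_ge1[of h] by auto
    then have "\<gamma> (s + h) \<noteq> \<gamma> s" using curve_eq_imp_integer_shift[of "s + h" s] by auto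
    then show ?thesis using scaleR_mean_velocity[of h s] by auto
  qed (simp add: velocity_nonzero)
  obtain p where p: "p \<in> {0..1} \<times> {-1/2..1/2}"
    "\<forall>q\<in>{0..1} \<times> {-1/2..1/2}.
       norm (case p of (s, h) \<Rightarrow> mean_velocity s h) \<le> norm (case q of (s, h) \<Rightarrow> mean_velocity s h)"
    using continuous_attains_inf[OF _ _ continuous_on_norm[OF continuous_mean_velocity],
        of "{0..1} \<times> {-1/2..1/2}"] by (auto simp: compact_Times)
  define c where "c = norm (case p of (s, h) \<Rightarrow> mean_velocity s h)"
  show thesis
  proof (rule that)
    show "0 < c" using nonzero p(1) by (auto simp: c_def abs_le_iff)
    fix s t :: real assume "s \<in> {0..1}" "\<bar>t - s\<bar> \<le> 1/2"
    then have "(s, t - s) \<in> {0..1} \<times> {-1/2..1/2}" unfolding abs_le_iff by auto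
    then have "c \<le> norm (mean_velocity s (t - s))" using p(2) unfolding c_def by fastforce
    then have "c * \<bar>t - s\<bar> \<le> norm ((t - s) *\<^sub>R mean_velocity s (t - s))"
      by (simp add: mult.commute[of c] mult_left_mono)
    then show "c * \<bar>t - s\<bar> \<le> norm (\<gamma> t - \<gamma> s)" by (simp add: scaleR_mean_velocity)
  qed
qed

lemma uniform_linear_approximation:
  assumes "0 < e"
  obtains r where "0 < r"
    "\<And>s t. s \<in> {0..1} \<Longrightarrow> \<bar>t - s\<bar> \<le> r \<Longrightarrow> norm (\<gamma> t - \<gamma> s - (t - s) *\<^sub>R velocity s) \<le> e * \<bar>t - s\<bar>"
proof -
  have "uniformly_continuous_on ({0..1} \<times> {-1..1}) (\<lambda>(s, h). mean_velocity s h)"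
    by (intro compact_uniformly_continuous continuous_mean_velocity compact_Times compact_Icc)
  then obtain d where d: "0 < d" "\<And>p q. p \<in> {0..1} \<times> {-1..1} \<Longrightarrow> q \<in> {0..1} \<times> {-1..1} \<Longrightarrow> dist q p < d
      \<Longrightarrow> dist (case q of (s, h) \<Rightarrow> mean_velocity s h) (case p of (s, h) \<Rightarrow> mean_velocity s h) < e"
    using assms unfolding uniformly_continuous_on_def by blast
  show thesis
  proof (rule that)
    show "0 < min 1 (d / 2)" using d(1) by simp
    fix s t assume s: "s \<in> {0..1}" and t: "\<bar>t - s\<bar> \<le> min 1 (d / 2)"
    have "norm (mean_velocity s (t - s) - mean_velocity s 0) \<le> e"
      using d(2)[of "(s, 0)" "(s, t - s)"] s t d(1) by (auto simp: dist_Pair_Pair dist_norm abs_le_iff)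
    then have "\<bar>t - s\<bar> * norm (mean_velocity s (t - s) - velocity s) \<le> \<bar>t - s\<bar> * e"
      by (intro mult_left_mono) auto
    moreover have "\<gamma> t - \<gamma> s - (t - s) *\<^sub>R velocity s = (t - s) *\<^sub>R (mean_velocity s (t - s) - velocity s)"
      unfolding scaleR_diff_right scaleR_mean_velocity by simp
    ultimately show "norm (\<gamma> t - \<gamma> s - (t - s) *\<^sub>R velocity s) \<le> e * \<bar>t - s\<bar>"
      by (simp add: mult.commute)
  qed
qed

lemma nearest_parameter:
  obtains t' where "\<gamma> t' = \<gamma> t" "\<bar>t' - s\<bar> \<le> 1/2"
proof
  show "\<gamma> (t - of_int (round (t - s))) = \<gamma> t" by (rule curve.minus_of_int)
  show "\<bar>t - of_int (round (t - s)) - s\<bar> \<le> 1/2"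
    using of_int_round_abs_le[of "t - s"] by (simp add: abs_minus_commute algebra_simps)
qed

lemma normal_displacement_near:
  assumes "norm (p - h *\<^sub>R v) \<le> norm v / 2 * \<bar>h\<bar>"
  shows "norm v / 2 * \<bar>\<eta>\<bar> \<le> norm (p - \<i> * of_real \<eta> * v)"
proof -
  define w where "w = Complex h (- \<eta>)"
  have w: "\<bar>h\<bar> \<le> norm w" "\<bar>\<eta>\<bar> \<le> norm w"
    using abs_Re_le_cmod[of w] abs_Im_le_cmod[of w] by (auto simp: w_def)
  have "p - \<i> * of_real \<eta> * v = w * v + (p - h *\<^sub>R v)"
    by (simp add: w_def complex_eq_iff)
  then have "norm w * norm v - norm (p - h *\<^sub>R v) \<le> norm (p - \<i> * of_real \<eta> * v)"
    by (metis norm_diff_ineq norm_mult)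
  moreover have "norm v / 2 * \<bar>h\<bar> \<le> norm v / 2 * norm w" "norm v / 2 * \<bar>\<eta>\<bar> \<le> norm v / 2 * norm w"
    using w by (intro mult_left_mono; simp)+
  ultimately show ?thesis using assms by (simp add: mult.commute)
qed

lemma normal_displacement_far:
  assumes "2 * (\<bar>\<eta>\<bar> * norm v) \<le> norm p"
  shows "\<bar>\<eta>\<bar> * norm v \<le> norm (p - \<i> * of_real \<eta> * v)"
  using assms norm_triangle_ineq2[of p "\<i> * of_real \<eta> * v"] by (simp add: norm_mult)

lemma infdist_normal_point:
  obtains \<kappa> \<eta>0 where "0 < \<kappa>" "0 < \<eta>0"
    "\<And>s \<eta>. s \<in> {0..1} \<Longrightarrow> 0 < \<eta> \<Longrightarrow> \<eta> \<le> \<eta>0 \<Longrightarrow> \<kappa> * \<eta> \<le> infdist (\<gamma> s + \<i> * of_real \<eta> * velocity s) \<Gamma>"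
proof -
  obtain m where m: "0 < m" "\<And>t. t \<in> {0..1} \<Longrightarrow> m \<le> norm (velocity t)"
    using speed_bounded_below by blast
  obtain L where L: "0 \<le> L" "\<And>t. t \<in> {0..1} \<Longrightarrow> norm (velocity t) \<le> L"
    using speed_bounded by blast
  obtain r where r: "0 < r"
    "\<And>s t. s \<in> {0..1} \<Longrightarrow> \<bar>t - s\<bar> \<le> r \<Longrightarrow> norm (\<gamma> t - \<gamma> s - (t - s) *\<^sub>R velocity s) \<le> (m/2) * \<bar>t - s\<bar>"
    using uniform_linear_approximation[of "m/2"] m by auto
  obtain c where c: "0 < c" "\<And>s t. s \<in> {0..1} \<Longrightarrow> \<bar>t - s\<bar> \<le> 1/2 \<Longrightarrow> c * \<bar>t - s\<bar> \<le> norm (\<gamma> t - \<gamma> s)"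
    using chord_arc by blast
  have mL: "m \<le> L" using m(2)[of 0] L(2)[of 0] by simp
  show thesis
  proof (rule that)
    show "0 < m/2" "0 < c * r / (2 * L)" using m c r mL by auto
    fix s \<eta> :: real assume s: "s \<in> {0..1}" and \<eta>: "0 < \<eta>" "\<eta> \<le> c * r / (2 * L)"
    define z where "z = \<gamma> s + \<i> * of_real \<eta> * velocity s"
    have "m/2 * \<eta> \<le> norm (\<gamma> t - z)" if t: "\<bar>t - s\<bar> \<le> 1/2" for t
    proof (cases "\<bar>t - s\<bar> \<le> r")
      case True
      have "m/2 * \<bar>t - s\<bar> \<le> norm (velocity s) / 2 * \<bar>t - s\<bar>" "m/2 * \<eta> \<le> norm (velocity s) / 2 * \<bar>\<eta>\<bar>"
        using m(2)[OF s] \<eta>(1) by (auto intro!: mult_right_mono)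
      then show ?thesis
        using normal_displacement_near[of "\<gamma> t - \<gamma> s" "t - s" "velocity s" \<eta>] r(2)[OF s True]
        by (simp add: z_def diff_diff_eq)
    next
      case False
      have "2 * (\<bar>\<eta>\<bar> * norm (velocity s)) \<le> 2 * (\<eta> * L)" using \<eta> L(2)[OF s] by simp
      also have "\<dots> \<le> c * r" using \<eta>(2) m(1) mL by (simp add: field_simps)
      also have "\<dots> \<le> c * \<bar>t - s\<bar>" using False c(1) by (intro mult_left_mono) auto
      also have "\<dots> \<le> norm (\<gamma> t - \<gamma> s)" by (rule c(2)[OF s t])
      finally have "\<eta> * norm (velocity s) \<le> norm (\<gamma> t - z)"
        using normal_displacement_far[of \<eta> "velocity s" "\<gamma> t - \<gamma> s"] \<eta>(1) by (simp add: z_def diff_diff_eq)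
      moreover have "m/2 * \<eta> \<le> norm (velocity s) * \<eta>" using m(1) m(2)[OF s] \<eta> by (intro mult_right_mono) auto
      ultimately show ?thesis by (simp add: mult.commute)
    qed
    then have "m/2 * \<eta> \<le> dist z \<zeta>" if "\<zeta> \<in> \<Gamma>" for \<zeta>
      using that by (metis path_imageE nearest_parameter dist_norm norm_minus_commute)
    then show "m/2 * \<eta> \<le> infdist (\<gamma> s + \<i> * of_real \<eta> * velocity s) \<Gamma>"
      unfolding z_def[symmetric] infdist_notempty[OF path_image_nonempty] by (intro cINF_greatest) auto
  qed
qed

text \<open>The corkscrew points lie on the normals; scales above \<open>\<eta>0\<close> only cost a larger constant.\<close>

lemma corkscrew:
  obtains K where "1 \<le> K"
    "\<And>a \<epsilon>. a \<in> \<Gamma> \<Longrightarrow> 0 < \<epsilon> \<Longrightarrow> \<epsilon> \<le> D \<Longrightarrow> \<exists>z. dist z a \<le> K * \<epsilon> \<and> \<epsilon> \<le> K * infdist z \<Gamma>"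
proof -
  obtain L where L: "0 \<le> L" "\<And>t. t \<in> {0..1} \<Longrightarrow> norm (velocity t) \<le> L"
    using speed_bounded by blast
  obtain \<kappa> \<eta>0 where \<kappa>: "0 < \<kappa>" and \<eta>0: "0 < \<eta>0"
    and normal: "\<And>s \<eta>. s \<in> {0..1} \<Longrightarrow> 0 < \<eta> \<Longrightarrow> \<eta> \<le> \<eta>0 \<Longrightarrow> \<kappa> * \<eta> \<le> infdist (\<gamma> s + \<i> * of_real \<eta> * velocity s) \<Gamma>"
    using infdist_normal_point by blast
  define E where "E = max 1 (D / \<eta>0)"
  have E: "1 \<le> E" "D \<le> E * \<eta>0" using \<eta>0 by (auto simp: E_def max_def field_simps)
  define K where "K = max 1 (max L (E / \<kappa>))"
  have K: "1 \<le> K" "L \<le> K" "E / \<kappa> \<le> K" by (auto simp: K_def)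
  show thesis
  proof (rule that[OF K(1)])
    fix a \<epsilon> assume "a \<in> \<Gamma>" and \<epsilon>: "0 < \<epsilon>" "\<epsilon> \<le> D"
    then obtain s where s: "s \<in> {0..1}" "a = \<gamma> s" using path_imageE by blast
    define \<eta> where "\<eta> = \<epsilon> / E"
    have \<eta>: "0 < \<eta>" "\<eta> \<le> \<epsilon>" "\<eta> \<le> \<eta>0" using E \<epsilon> by (auto simp: \<eta>_def field_simps intro: order_trans)
    define z where "z = \<gamma> s + \<i> * of_real \<eta> * velocity s"
    have "dist z a = \<eta> * norm (velocity s)" using \<eta> by (simp add: z_def s dist_norm norm_mult)
    also have "\<dots> \<le> \<epsilon> * K" using \<eta> L(2)[OF s(1)] K by (intro mult_mono) auto
    finally have "dist z a \<le> K * \<epsilon>" by (simp add: mult.commute)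
    moreover have "\<epsilon> \<le> K * infdist z \<Gamma>"
    proof -
      have "\<epsilon> = E / \<kappa> * (\<kappa> * \<eta>)" using \<kappa> E by (simp add: \<eta>_def)
      also have "\<dots> \<le> K * infdist z \<Gamma>"
        using normal[OF s(1) \<eta>(1,3)] K \<kappa> \<eta>(1) by (intro mult_mono) (auto simp: z_def)
      finally show ?thesis .
    qed
    ultimately show "\<exists>z. dist z a \<le> K * \<epsilon> \<and> \<epsilon> \<le> K * infdist z \<Gamma>" by blast
  qed
qed

definition nontangential :: "real \<Rightarrow> complex \<Rightarrow> complex \<Rightarrow> bool" where
  "nontangential K a z \<longleftrightarrow> z \<notin> \<Gamma> \<and> dist z a \<le> K * infdist z \<Gamma>"

lemma common_nontangential_point:
  obtains K where "0 \<le> K"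
    "\<And>a b. a \<in> \<Gamma> \<Longrightarrow> b \<in> \<Gamma> \<Longrightarrow> a \<noteq> b \<Longrightarrow> \<exists>z. nontangential K a z \<and> nontangential K b z \<and>
       dist z a \<le> K * dist a b \<and> dist z b \<le> K * dist a b"
proof -
  obtain D where D: "\<And>x y. x \<in> \<Gamma> \<Longrightarrow> y \<in> \<Gamma> \<Longrightarrow> dist x y \<le> D"
    using bounded_simple_path_image[OF simple_path_curve] unfolding bounded_two_points by blast
  obtain K where K: "1 \<le> K" "\<And>a \<epsilon>. a \<in> \<Gamma> \<Longrightarrow> 0 < \<epsilon> \<Longrightarrow> \<epsilon> \<le> D \<Longrightarrow> \<exists>z. dist z a \<le> K * \<epsilon> \<and> \<epsilon> \<le> K * infdist z \<Gamma>"
    using corkscrew by blast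
  define K' where "K' = (K + 1) * K"
  have "\<exists>z. nontangential K' a z \<and> nontangential K' b z \<and> dist z a \<le> K' * dist a b \<and> dist z b \<le> K' * dist a b"
    if ab: "a \<in> \<Gamma>" "b \<in> \<Gamma>" "a \<noteq> b" for a b
  proof -
    define \<epsilon> where "\<epsilon> = dist a b"
    have \<epsilon>: "0 < \<epsilon>" "\<epsilon> \<le> D" using D[OF ab(1,2)] ab(3) by (auto simp: \<epsilon>_def)
    obtain z where z: "dist z a \<le> K * \<epsilon>" "\<epsilon> \<le> K * infdist z \<Gamma>" using K(2)[OF ab(1) \<epsilon>] by blast
    have "z \<notin> \<Gamma>" using z(2) \<epsilon>(1) by auto
    moreover have "dist z a \<le> (K + 1) * \<epsilon>" "dist z b \<le> (K + 1) * \<epsilon>"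
      using z(1) \<epsilon>(1) dist_triangle[of z b a, folded \<epsilon>_def] by (auto simp: distrib_right)
    moreover have "(K + 1) * \<epsilon> \<le> K' * \<epsilon>" "(K + 1) * \<epsilon> \<le> K' * infdist z \<Gamma>"
      using z(2) K(1) \<epsilon>(1) unfolding K'_def mult.assoc by (auto intro!: mult_left_mono)
    ultimately show ?thesis unfolding \<epsilon>_def nontangential_def by (meson order_trans)
  qed
  then show thesis using that[of K'] K(1) by (simp add: K'_def)
qed

lemma winding_number_eq_near:
  assumes "dist z w < infdist z \<Gamma>"
  shows "w \<notin> \<Gamma>" "winding_number \<gamma> w = winding_number \<gamma> z"
proof -
  have disjoint: "ball z (infdist z \<Gamma>) \<inter> \<Gamma> = {}"
    unfolding disjoint_iff mem_ball by (meson infdist_le not_le)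
  then show "w \<notin> \<Gamma>" using assms by auto
  have "z \<in> ball z (infdist z \<Gamma>)" using assms zero_le_dist[of z w] by (simp del: zero_le_dist)
  then show "winding_number \<gamma> w = winding_number \<gamma> z"
    using assms disjoint simple_path_imp_path[OF simple_path_curve] closed_curve
    by (intro winding_number_eq[of _ _ "ball z (infdist z \<Gamma>)"]) auto
qed

end

subsection \<open>Contour integrals along a regular Jordan curve\<close>

context regular_jordan_curve
begin

lemma contour_integrable_continuous:
  assumes "continuous_on \<Gamma> f"
  shows "f contour_integrable_on \<gamma>"
  unfolding contour_integrable_on
  by (intro integrable_continuous_real continuous_on_mult continuous_velocity
        continuous_on_compose2[OF assms continuous_curve]) auto

lemma cauchy_kernel_contour_integrable:
  assumes "continuous_on \<Gamma> F" "z \<notin> \<Gamma>"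
  shows "(\<lambda>\<zeta>. F \<zeta> / (\<zeta> - z)) contour_integrable_on \<gamma>"
  using assms by (intro contour_integrable_continuous continuous_intros) auto

lemma holomorphic_on_cauchy_int:
  assumes F: "continuous_on \<Gamma> F"
  shows "cauchy_int \<gamma> F holomorphic_on - \<Gamma>"
proof -
  obtain L where L: "0 \<le> L" "\<And>t. t \<in> {0..1} \<Longrightarrow> norm (velocity t) \<le> L" using speed_bounded by blast
  have int: "((\<lambda>\<zeta>. F \<zeta> / (\<zeta> - w) ^ 1) has_contour_integral contour_integral \<gamma> (\<lambda>\<zeta>. F \<zeta> / (\<zeta> - w))) \<gamma>"
    if "w \<in> UNIV - \<Gamma>" for w
    using cauchy_kernel_contour_integrable[OF F] that by (simp add: has_contour_integral_integral)
  have "((\<lambda>w. contour_integral \<gamma> (\<lambda>\<zeta>. F \<zeta> / (\<zeta> - w))) has_field_derivative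
      of_nat 1 * contour_integral \<gamma> (\<lambda>\<zeta>. F \<zeta> / (\<zeta> - w) ^ Suc 1)) (at w)" if "w \<notin> \<Gamma>" for w
    by (rule Cauchy_next_derivative(2)[OF F L(2) int _ open_UNIV valid_path_curve]) (use that in auto)
  then have "(\<lambda>w. contour_integral \<gamma> (\<lambda>\<zeta>. F \<zeta> / (\<zeta> - w))) holomorphic_on - \<Gamma>"
    by (meson ComplD field_differentiable_at_within field_differentiable_def holomorphic_onI)
  then show ?thesis unfolding cauchy_int_def by (intro holomorphic_intros) auto
qed

lemma uniform_limit_cauchy_kernel_at_infinity:
  assumes F: "continuous_on \<Gamma> F"
  shows "uniform_limit \<Gamma> (\<lambda>z \<zeta>. F \<zeta> / (\<zeta> - z)) (\<lambda>\<zeta>. 0) at_infinity"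
proof (rule uniform_limitI)
  fix e :: real assume e: "0 < e"
  have compact: "compact \<Gamma>" by (rule compact_simple_path_image[OF simple_path_curve])
  obtain R where R: "\<And>\<zeta>. \<zeta> \<in> \<Gamma> \<Longrightarrow> norm \<zeta> \<le> R"
    using compact_imp_bounded[OF compact] unfolding bounded_iff by blast
  obtain N where N: "\<And>\<zeta>. \<zeta> \<in> \<Gamma> \<Longrightarrow> norm (F \<zeta>) \<le> N"
    using compact_imp_bounded[OF compact_continuous_image[OF F compact]] unfolding bounded_iff by blast
  have "\<forall>\<^sub>F z in at_infinity. R + \<bar>N\<bar> / e < norm (z :: complex)"
    by (rule eventually_at_infinityI[of "R + \<bar>N\<bar> / e + 1"]) simp
  then show "\<forall>\<^sub>F z in at_infinity. \<forall>\<zeta>\<in>\<Gamma>. dist (F \<zeta> / (\<zeta> - z)) 0 < e"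
  proof eventually_elim
    case (elim z)
    have "norm (F \<zeta>) / norm (\<zeta> - z) < e" if "\<zeta> \<in> \<Gamma>" for \<zeta>
    proof -
      have "\<bar>N\<bar> / e < norm z - R" using elim by simp
      also have "\<dots> \<le> norm z - norm \<zeta>" using R[OF that] by simp
      also have "\<dots> \<le> norm (\<zeta> - z)" by norm
      finally have "\<bar>N\<bar> < e * norm (\<zeta> - z)" "0 < norm (\<zeta> - z)" using e
        by (auto simp: divide_less_eq mult.commute intro: le_less_trans[rotated])
      then show ?thesis using N[OF that] by (simp add: divide_less_eq)
    qed
    then show ?case by (simp add: norm_divide)
  qed
qed

lemma cauchy_int_tendsto_0:
  assumes F: "continuous_on \<Gamma> F"
  shows "(cauchy_int \<gamma> F \<longlongrightarrow> 0) at_infinity"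
proof -
  obtain L where L: "0 \<le> L" "\<And>t. t \<in> {0..1} \<Longrightarrow> norm (velocity t) \<le> L" using speed_bounded by blast
  obtain R where R: "\<And>\<zeta>. \<zeta> \<in> \<Gamma> \<Longrightarrow> norm \<zeta> < R"
    using bounded_simple_path_image[OF simple_path_curve] unfolding bounded_pos_less by blast
  have "\<forall>\<^sub>F z in at_infinity. (\<lambda>\<zeta>. F \<zeta> / (\<zeta> - z)) contour_integrable_on \<gamma>"
    using R by (intro eventually_at_infinityI[of R] cauchy_kernel_contour_integrable[OF F]) force
  from contour_integral_uniform_limit(2)[OF this uniform_limit_cauchy_kernel_at_infinity[OF F] L(2) valid_path_curve]
  have "((\<lambda>z. contour_integral \<gamma> (\<lambda>\<zeta>. F \<zeta> / (\<zeta> - z))) \<longlongrightarrow> 0) at_infinity"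
    by (simp add: trivial_limit_at_infinity)
  then show ?thesis unfolding cauchy_int_def by (rule tendsto_divide_zero)
qed

lemma weak_kernel_dominated:
  assumes "\<sigma> \<le> 1"
  obtains c where "0 < c"
    "\<And>s t d. s \<in> {0..1} \<Longrightarrow> t \<in> {0..1} \<Longrightarrow> 0 < d \<Longrightarrow> weak_kernel \<sigma> d (norm (\<gamma> t - \<gamma> s)) \<le> weak_majorant \<sigma> d c s t"
proof -
  obtain c where c: "0 < c" "\<And>s t. s \<in> {0..1} \<Longrightarrow> \<bar>t - s\<bar> \<le> 1/2 \<Longrightarrow> c * \<bar>t - s\<bar> \<le> norm (\<gamma> t - \<gamma> s)"
    using chord_arc by blast
  have "weak_kernel \<sigma> d (norm (\<gamma> t - \<gamma> s)) \<le> weak_majorant \<sigma> d c s t"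
    if s: "s \<in> {0..1}" and t: "t \<in> {0..1}" and d: "0 < d" for s t d
  proof -
    define k where "k = round (t - s)"
    have k: "k \<in> {-1, 0, 1}"
      using round_mono[of "of_int (-1)" "t - s"] round_mono[of "t - s" "of_int 1"] s t
      unfolding round_of_int k_def by auto
    have "\<bar>(t - of_int k) - s\<bar> \<le> 1/2"
      using of_int_round_abs_le[of "t - s"] by (simp add: k_def abs_minus_commute algebra_simps)
    then have le: "c * \<bar>t - (s + of_int k)\<bar> \<le> norm (\<gamma> t - \<gamma> s)"
      using c(2)[OF s, of "t - of_int k"] by (simp add: curve.minus_of_int diff_diff_eq add.commute)
    have "weak_kernel \<sigma> d (norm (\<gamma> t - \<gamma> s)) \<le> weak_kernel \<sigma> d (c * \<bar>t - (s + of_int k)\<bar>)"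
    proof (cases "t = s + of_int k")
      case False
      then show ?thesis using assms d c(1) by (intro weak_kernel_antimono le) auto
    qed (simp add: curve.plus_of_int)
    also have "\<dots> \<le> weak_majorant \<sigma> d c s t" using k d c(1) by (intro weak_kernel_le_majorant) auto
    finally show ?thesis .
  qed
  then show thesis using that[OF c(1)] by blast
qed

lemma contour_integral_dominated:
  assumes f: "(\<lambda>t. f (\<gamma> t)) \<in> borel_measurable borel" and g: "g integrable_on {0..1}"
    and f_g: "\<And>t. t \<in> {0..1} \<Longrightarrow> norm (f (\<gamma> t)) \<le> g t" and L: "\<And>t. t \<in> {0..1} \<Longrightarrow> norm (velocity t) \<le> L"
  shows "f contour_integrable_on \<gamma>" "norm (contour_integral \<gamma> f) \<le> integral {0..1} g * L"
proof -
  have gL: "(\<lambda>t. g t * L) integrable_on {0..1}" using g by (rule integrable_on_mult_left)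
  have dominated: "norm (f (\<gamma> t) * velocity t) \<le> g t * L" if "t \<in> {0..1}" for t
    unfolding norm_mult using f_g[OF that] L[OF that]
    by (intro mult_mono) (auto intro: order_trans[OF norm_ge_zero])
  have measurable: "(\<lambda>t. f (\<gamma> t) * velocity t) \<in> borel_measurable (lebesgue_on {0..1})"
    using f borel_measurable_continuous_onI[OF continuous_velocity]
    by (simp add: measurable_restrict_space1 measurable_completion)
  have int: "(\<lambda>t. f (\<gamma> t) * velocity t) integrable_on {0..1}"
    by (rule measurable_bounded_by_integrable_imp_integrable[OF measurable gL dominated]) auto
  then show "f contour_integrable_on \<gamma>" by (simp add: contour_integrable_on)
  have "norm (contour_integral \<gamma> f) \<le> integral {0..1} (\<lambda>t. g t * L)"
    unfolding contour_integral_integral by (rule integral_norm_bound_integral[OF int gL dominated])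
  then show "norm (contour_integral \<gamma> f) \<le> integral {0..1} g * L" by simp
qed

lemma contour_integral_weak_kernel_bound:
  assumes \<sigma>: "0 < \<sigma>" "\<sigma> < 1"
  obtains C where "0 \<le> C"
    "\<And>f a d B. (\<lambda>t. f (\<gamma> t)) \<in> borel_measurable borel \<Longrightarrow> a \<in> \<Gamma> \<Longrightarrow> 0 < d \<Longrightarrow> 0 \<le> B \<Longrightarrow>
       (\<And>\<zeta>. \<zeta> \<in> \<Gamma> \<Longrightarrow> norm (f \<zeta>) \<le> B * weak_kernel \<sigma> d (dist \<zeta> a)) \<Longrightarrow>
       f contour_integrable_on \<gamma> \<and> norm (contour_integral \<gamma> f) \<le> B * C * d powr \<sigma>"
proof -
  obtain L where L: "0 \<le> L" "\<And>t. t \<in> {0..1} \<Longrightarrow> norm (velocity t) \<le> L" using speed_bounded by blast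
  obtain c where c: "0 < c" "\<And>s t d. s \<in> {0..1} \<Longrightarrow> t \<in> {0..1} \<Longrightarrow> 0 < d \<Longrightarrow>
      weak_kernel \<sigma> d (norm (\<gamma> t - \<gamma> s)) \<le> weak_majorant \<sigma> d c s t"
    using weak_kernel_dominated[OF less_imp_le[OF \<sigma>(2)]] by blast
  define I where "I = 3 * (weak_mass \<sigma> / c)"
  have "0 \<le> I" using c(1) by (simp add: I_def weak_mass_nonneg)
  have "f contour_integrable_on \<gamma> \<and> norm (contour_integral \<gamma> f) \<le> B * (I * L) * d powr \<sigma>"
    if f: "(\<lambda>t. f (\<gamma> t)) \<in> borel_measurable borel" and a: "a \<in> \<Gamma>" and d: "0 < d" and B: "0 \<le> B"
      and bound: "\<And>\<zeta>. \<zeta> \<in> \<Gamma> \<Longrightarrow> norm (f \<zeta>) \<le> B * weak_kernel \<sigma> d (dist \<zeta> a)" for f a d B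
  proof -
    obtain s where s: "s \<in> {0..1}" "a = \<gamma> s" using a by (rule path_imageE)
    have "norm (f (\<gamma> t)) \<le> B * weak_majorant \<sigma> d c s t" if "t \<in> {0..1}" for t
      using bound[of "\<gamma> t"] mult_left_mono[OF c(2)[OF s(1) that d] B] by (simp add: s(2) dist_norm)
    note f_bounds = contour_integral_dominated
      [OF f integrable_on_mult_right[OF weak_majorant_integral(1)[OF \<sigma> d c(1)]] this L(2)]
    have "norm (contour_integral \<gamma> f) \<le> B * integral {0..1} (weak_majorant \<sigma> d c s) * L"
      using f_bounds(2) by simp
    also have "\<dots> \<le> B * (I * d powr \<sigma>) * L"
      unfolding I_def by (intro mult_right_mono mult_left_mono weak_majorant_integral(2) \<sigma> d c(1) B L(1))
    finally show ?thesis using f_bounds(1) by (simp add: mult_ac)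
  qed
  then show thesis using that[of "I * L"] \<open>0 \<le> I\<close> L(1) by simp
qed

end

subsection \<open>Cauchy integrals of Hoelder densities\<close>

lemma norm_divide_2_pi_i_le: "norm (z / (2 * pi * \<i>)) \<le> norm z"
proof -
  have "norm z / (2 * pi) \<le> norm z / 1" using pi_ge_two by (intro divide_left_mono) auto
  then show ?thesis by (simp add: norm_divide norm_mult)
qed

lemma norm_cauchy_kernel_diff_le:
  fixes \<Delta> :: complex
  assumes \<Delta>: "norm \<Delta> \<le> M * dist \<zeta> a powr \<sigma>" and M: "0 \<le> M" and N: "0 \<le> N" and d: "0 < d"
    and separated: "dist \<zeta> a * (dist \<zeta> a + d) \<le> N * (dist \<zeta> z * dist \<zeta> w)"
  shows "norm (\<Delta> / (\<zeta> - z) - \<Delta> / (\<zeta> - w)) \<le> M * N * (dist z w / d) * weak_kernel \<sigma> d (dist \<zeta> a)"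
proof (cases "\<zeta> = a")
  case True
  then show ?thesis using \<Delta> by simp
next
  case False
  define u where "u = dist \<zeta> a"
  have u: "0 < u" "0 < u * (u + d)" using False d by (auto simp: u_def add_pos_pos)
  then have pos: "0 < dist \<zeta> z * dist \<zeta> w"
    using separated N by (auto simp: u_def zero_less_mult_iff less_le)
  then have "\<Delta> / (\<zeta> - z) - \<Delta> / (\<zeta> - w) = \<Delta> * (z - w) / ((\<zeta> - z) * (\<zeta> - w))"
    by (auto simp: divide_simps) (auto simp: algebra_simps)
  then have "norm (\<Delta> / (\<zeta> - z) - \<Delta> / (\<zeta> - w)) = norm \<Delta> * dist z w * (1 / (dist \<zeta> z * dist \<zeta> w))"
    by (simp add: norm_mult norm_divide dist_norm)
  also have "\<dots> \<le> (M * u powr \<sigma>) * dist z w * (N / (u * (u + d)))"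
  proof (intro mult_mono)
    show "1 / (dist \<zeta> z * dist \<zeta> w) \<le> N / (u * (u + d))"
      using separated pos u(2) by (simp add: u_def frac_le_eq divide_simps)
  qed (use \<Delta> M pos in \<open>auto simp: u_def\<close>)
  also have "\<dots> = M * N * (dist z w / d) * weak_kernel \<sigma> d u"
    using u d by (simp add: weak_kernel_def powr_diff)
  finally show ?thesis by (simp add: u_def)
qed

locale holder_density = regular_jordan_curve +
  fixes F :: "complex \<Rightarrow> complex" and \<sigma> :: real
  assumes \<sigma>: "0 < \<sigma>" "\<sigma> < 1" and holder: "holder_on \<sigma> \<Gamma> F"
begin

lemma continuous_density: "continuous_on \<Gamma> F"
  using holder \<sigma>(1) by (rule holder_on_imp_continuous_on)

definition cauchy_diff :: "complex \<Rightarrow> complex \<Rightarrow> complex" where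
  "cauchy_diff z a = contour_integral \<gamma> (\<lambda>\<zeta>. (F \<zeta> - F a) / (\<zeta> - z))"

text \<open>
  This makes \<open>\<bar>\<zeta> - a\<bar> powr \<sigma>\<close> times the difference of the Cauchy kernels at \<open>z\<close> and \<open>w\<close> a multiple of the
  weakly singular kernel.
\<close>

definition separated :: "real \<Rightarrow> real \<Rightarrow> complex \<Rightarrow> complex \<Rightarrow> complex \<Rightarrow> bool" where
  "separated N d a z w \<longleftrightarrow> 0 < d \<and> dist z w \<le> d \<and>
     (\<forall>\<zeta>\<in>\<Gamma>. dist \<zeta> a * (dist \<zeta> a + d) \<le> N * (dist \<zeta> z * dist \<zeta> w))"

lemma separated_nontangential:
  assumes "a \<in> \<Gamma>" "0 \<le> K" "nontangential K a z"
  shows "separated (1 + 2 * K) (dist z a) a z a"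
  unfolding separated_def
proof (intro conjI ballI)
  show "0 < dist z a" using assms(1,3) by (auto simp: nontangential_def)
  fix \<zeta> assume "\<zeta> \<in> \<Gamma>"
  then have "K * infdist z \<Gamma> \<le> K * dist z \<zeta>" using assms(2) by (intro mult_left_mono infdist_le)
  then have "dist \<zeta> a + dist z a \<le> (1 + 2 * K) * dist \<zeta> z"
    using assms(3) dist_triangle[of \<zeta> a z] by (simp add: nontangential_def dist_commute algebra_simps)
  then have "dist \<zeta> a * (dist \<zeta> a + dist z a) \<le> dist \<zeta> a * ((1 + 2 * K) * dist \<zeta> z)"
    by (intro mult_left_mono) auto
  then show "dist \<zeta> a * (dist \<zeta> a + dist z a) \<le> (1 + 2 * K) * (dist \<zeta> z * dist \<zeta> a)"
    by (simp add: mult_ac)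
qed simp

lemma separated_interior:
  assumes "a \<in> \<Gamma>" "z \<notin> \<Gamma>" "infdist z \<Gamma> = dist z a" "2 * dist z w \<le> dist z a"
  shows "separated 18 (dist z a) a z w"
  unfolding separated_def
proof (intro conjI ballI)
  show "0 < dist z a" using assms(1,2) by auto
  show "dist z w \<le> dist z a" using assms(4) zero_le_dist[of z w] by linarith
  fix \<zeta> assume "\<zeta> \<in> \<Gamma>"
  then have "dist z a \<le> dist \<zeta> z"
    unfolding assms(3)[symmetric] dist_commute[of \<zeta>] by (rule infdist_le)
  then have le: "dist \<zeta> a + dist z a \<le> 3 * dist \<zeta> z" "dist \<zeta> a + dist z a \<le> 6 * dist \<zeta> w"
    using dist_triangle[of \<zeta> a z] dist_triangle[of \<zeta> z w] assms(4) by (auto simp: dist_commute)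
  have "dist \<zeta> a * (dist \<zeta> a + dist z a) \<le> (dist \<zeta> a + dist z a) * (dist \<zeta> a + dist z a)"
    by (intro mult_right_mono) auto
  also have "\<dots> \<le> (3 * dist \<zeta> z) * (6 * dist \<zeta> w)" by (intro mult_mono le) auto
  finally show "dist \<zeta> a * (dist \<zeta> a + dist z a) \<le> 18 * (dist \<zeta> z * dist \<zeta> w)" by simp
qed

lemma cauchy_diff_separated:
  obtains C where "0 \<le> C"
    "\<And>N d a z w. a \<in> \<Gamma> \<Longrightarrow> z \<notin> \<Gamma> \<Longrightarrow> 0 \<le> N \<Longrightarrow> separated N d a z w \<Longrightarrow>
       norm (cauchy_diff z a - cauchy_diff w a) \<le> C * N * dist z w powr \<sigma>"
proof -
  obtain M where M: "0 \<le> M" "\<And>x y. x \<in> \<Gamma> \<Longrightarrow> y \<in> \<Gamma> \<Longrightarrow> norm (F x - F y) \<le> M * dist x y powr \<sigma>"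
    using holder unfolding holder_on_altdef by blast
  obtain C where C: "0 \<le> C"
    "\<And>f a d B. (\<lambda>t. f (\<gamma> t)) \<in> borel_measurable borel \<Longrightarrow> a \<in> \<Gamma> \<Longrightarrow> 0 < d \<Longrightarrow> 0 \<le> B \<Longrightarrow>
       (\<And>\<zeta>. \<zeta> \<in> \<Gamma> \<Longrightarrow> norm (f \<zeta>) \<le> B * weak_kernel \<sigma> d (dist \<zeta> a)) \<Longrightarrow>
       f contour_integrable_on \<gamma> \<and> norm (contour_integral \<gamma> f) \<le> B * C * d powr \<sigma>"
    using contour_integral_weak_kernel_bound[OF \<sigma>] by blast
  have "norm (cauchy_diff z a - cauchy_diff w a) \<le> M * C * N * dist z w powr \<sigma>"
    if a: "a \<in> \<Gamma>" and z: "z \<notin> \<Gamma>" and N: "0 \<le> N" and sep: "separated N d a z w" for N d a z w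
  proof -
    have d: "0 < d" "dist z w \<le> d" using sep by (auto simp: separated_def)
    define f where "f = (\<lambda>\<zeta>. (F \<zeta> - F a) / (\<zeta> - z) - (F \<zeta> - F a) / (\<zeta> - w))"
    define B where "B = M * N * (dist z w / d)"
    have "(\<lambda>t. f (\<gamma> t)) \<in> borel_measurable borel"
      unfolding f_def
      by (intro borel_measurable_diff borel_measurable_divide borel_measurable_const borel_measurable_continuous_onI
            continuous_curve continuous_on_compose2[OF continuous_density continuous_curve]) auto
    moreover have "norm (f \<zeta>) \<le> B * weak_kernel \<sigma> d (dist \<zeta> a)" if "\<zeta> \<in> \<Gamma>" for \<zeta>
      unfolding f_def B_def using sep that
      by (intro norm_cauchy_kernel_diff_le M(2)[OF that a] M(1) N d(1)) (auto simp: separated_def)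
    ultimately have f: "f contour_integrable_on \<gamma>" "norm (contour_integral \<gamma> f) \<le> B * C * d powr \<sigma>"
      using C(2)[of f a d B] a d(1) M(1) N by (auto simp: B_def)
    have zI: "(\<lambda>\<zeta>. (F \<zeta> - F a) / (\<zeta> - z)) contour_integrable_on \<gamma>"
      by (intro cauchy_kernel_contour_integrable z continuous_intros continuous_density)
    have wI: "(\<lambda>\<zeta>. (F \<zeta> - F a) / (\<zeta> - w)) contour_integrable_on \<gamma>"
      using contour_integrable_diff[OF zI f(1)] by (simp add: f_def)
    have "norm (cauchy_diff z a - cauchy_diff w a) \<le> B * C * d powr \<sigma>"
      using f(2) contour_integral_diff[OF zI wI] by (simp add: cauchy_diff_def f_def)
    also have "\<dots> = M * C * N * (dist z w * d powr (\<sigma> - 1))"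
      using d by (simp add: B_def powr_diff)
    also have "\<dots> \<le> M * C * N * dist z w powr \<sigma>"
      using \<sigma>(2) d M(1) C(1) N by (intro mult_left_mono mult_powr_le_powr) auto
    finally show ?thesis .
  qed
  then show thesis using that[of "M * C"] M(1) C(1) by simp
qed

lemma cauchy_diff_nontangential:
  assumes "0 \<le> K"
  obtains C where "0 \<le> C"
    "\<And>a z. a \<in> \<Gamma> \<Longrightarrow> nontangential K a z \<Longrightarrow>
       norm (cauchy_diff z a - cauchy_diff a a) \<le> C * dist z a powr \<sigma>"
proof -
  obtain C where C: "0 \<le> C"
    "\<And>N d a z w. a \<in> \<Gamma> \<Longrightarrow> z \<notin> \<Gamma> \<Longrightarrow> 0 \<le> N \<Longrightarrow> separated N d a z w \<Longrightarrow>
       norm (cauchy_diff z a - cauchy_diff w a) \<le> C * N * dist z w powr \<sigma>"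
    using cauchy_diff_separated by blast
  show thesis
  proof (rule that)
    show "0 \<le> C * (1 + 2 * K)" using C(1) assms by simp
    show "norm (cauchy_diff z a - cauchy_diff a a) \<le> C * (1 + 2 * K) * dist z a powr \<sigma>"
      if a: "a \<in> \<Gamma>" and z: "nontangential K a z" for a z
      using C(2)[OF a _ _ separated_nontangential[OF a assms z]] assms z by (simp add: nontangential_def)
  qed
qed

lemma cauchy_int_eq_cauchy_diff:
  assumes "z \<notin> \<Gamma>"
  shows "cauchy_int \<gamma> F z = cauchy_diff z a / (2 * pi * \<i>) + F a * winding_number \<gamma> z"
proof -
  have int: "(\<lambda>\<zeta>. (F \<zeta> - F a) / (\<zeta> - z)) contour_integrable_on \<gamma>" "(\<lambda>\<zeta>. 1 / (\<zeta> - z)) contour_integrable_on \<gamma>"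
    by (intro cauchy_kernel_contour_integrable assms continuous_intros continuous_density)+
  have "contour_integral \<gamma> (\<lambda>\<zeta>. F \<zeta> / (\<zeta> - z)) =
      contour_integral \<gamma> (\<lambda>\<zeta>. (F \<zeta> - F a) / (\<zeta> - z) + F a * (1 / (\<zeta> - z)))"
    by (intro contour_integral_eq) (simp add: diff_divide_distrib)
  also have "\<dots> = cauchy_diff z a + F a * contour_integral \<gamma> (\<lambda>\<zeta>. 1 / (\<zeta> - z))"
    unfolding cauchy_diff_def
    by (simp only: contour_integral_add contour_integral_lmul contour_integrable_lmul int)
  finally show ?thesis
    unfolding cauchy_int_def winding_number_valid_path[OF valid_path_curve assms] by (simp add: add_divide_distrib)
qed

lemma cauchy_int_holder_interior:
  obtains C where "0 \<le> C"
    "\<And>z w. z \<notin> \<Gamma> \<Longrightarrow> 2 * dist z w \<le> infdist z \<Gamma> \<Longrightarrow>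
       norm (cauchy_int \<gamma> F z - cauchy_int \<gamma> F w) \<le> C * dist z w powr \<sigma>"
proof -
  obtain C where C: "0 \<le> C"
    "\<And>N d a z w. a \<in> \<Gamma> \<Longrightarrow> z \<notin> \<Gamma> \<Longrightarrow> 0 \<le> N \<Longrightarrow> separated N d a z w \<Longrightarrow>
       norm (cauchy_diff z a - cauchy_diff w a) \<le> C * N * dist z w powr \<sigma>"
    using cauchy_diff_separated by blast
  have "norm (cauchy_int \<gamma> F z - cauchy_int \<gamma> F w) \<le> C * 18 * dist z w powr \<sigma>"
    if z: "z \<notin> \<Gamma>" and zw: "2 * dist z w \<le> infdist z \<Gamma>" for z w
  proof -
    have "0 < infdist z \<Gamma>"
      by (rule infdist_pos_not_in_closed[OF closed_path_image_curve path_image_nonempty z])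
    then have near: "dist z w < infdist z \<Gamma>" using zw by linarith
    obtain a where a: "a \<in> \<Gamma>" "infdist z \<Gamma> = dist z a"
      using infdist_attains_inf[OF closed_path_image_curve path_image_nonempty] by blast
    have "cauchy_int \<gamma> F z - cauchy_int \<gamma> F w = (cauchy_diff z a - cauchy_diff w a) / (2 * pi * \<i>)"
      using cauchy_int_eq_cauchy_diff[OF z, of a] cauchy_int_eq_cauchy_diff[of w a] winding_number_eq_near[OF near]
      by (simp add: diff_divide_distrib)
    then have "norm (cauchy_int \<gamma> F z - cauchy_int \<gamma> F w) \<le> norm (cauchy_diff z a - cauchy_diff w a)"
      using norm_divide_2_pi_i_le by metis
    also have "\<dots> \<le> C * 18 * dist z w powr \<sigma>"
      using zw a(2) by (intro C(2)[OF a(1) z _ separated_interior[OF a(1) z a(2)]]) auto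
    finally show ?thesis .
  qed
  then show thesis using that[of "C * 18"] C(1) by simp
qed

lemma norm_cauchy_diff_change_base_le:
  assumes "z \<notin> \<Gamma>"
  shows "norm (cauchy_diff z a - cauchy_diff z b) \<le> 2 * pi * norm (F a - F b)"
proof -
  have "cauchy_diff z a - cauchy_diff z b = (2 * pi * \<i>) * winding_number \<gamma> z * (F b - F a)"
    using cauchy_int_eq_cauchy_diff[OF assms, of a] cauchy_int_eq_cauchy_diff[OF assms, of b]
    by (simp add: field_simps)
  moreover have "norm (winding_number \<gamma> z) \<le> 1"
    using simple_closed_path_winding_number_cases[OF simple_path_curve closed_curve assms] by auto
  ultimately show ?thesis
    using mult_right_mono[of "norm (winding_number \<gamma> z)" 1 "norm (F b - F a)"]
    by (simp add: norm_mult norm_minus_commute)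
qed

text \<open>
  Two points of the curve are compared through a corkscrew point for their distance; on which side of
  the curve it lies is irrelevant, since the change of base point costs a multiple of the increment of \<open>F\<close>.
\<close>

lemma holder_on_cauchy_diff_diagonal: "holder_on \<sigma> \<Gamma> (\<lambda>a. cauchy_diff a a)"
proof -
  obtain M where M: "\<And>x y. x \<in> \<Gamma> \<Longrightarrow> y \<in> \<Gamma> \<Longrightarrow> norm (F x - F y) \<le> M * dist x y powr \<sigma>"
    using holder unfolding holder_on_def by blast
  obtain K where K: "0 \<le> K" "\<And>a b. a \<in> \<Gamma> \<Longrightarrow> b \<in> \<Gamma> \<Longrightarrow> a \<noteq> b \<Longrightarrow> \<exists>z. nontangential K a z \<and> nontangential K b z \<and>
       dist z a \<le> K * dist a b \<and> dist z b \<le> K * dist a b"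
    using common_nontangential_point by metis
  obtain C where C: "0 \<le> C" "\<And>a z. a \<in> \<Gamma> \<Longrightarrow> nontangential K a z \<Longrightarrow>
       norm (cauchy_diff z a - cauchy_diff a a) \<le> C * dist z a powr \<sigma>"
    using cauchy_diff_nontangential[OF K(1)] by blast
  have "norm (cauchy_diff a a - cauchy_diff b b) \<le> (2 * (C * K powr \<sigma>) + 2 * pi * M) * dist a b powr \<sigma>"
    if ab: "a \<in> \<Gamma>" "b \<in> \<Gamma>" for a b
  proof (cases "a = b")
    case False
    obtain z where z: "nontangential K a z" "nontangential K b z" "dist z a \<le> K * dist a b" "dist z b \<le> K * dist a b"
      using K(2)[OF ab False] by blast
    have approach: "norm (cauchy_diff z x - cauchy_diff x x) \<le> C * (K powr \<sigma> * dist a b powr \<sigma>)"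
      if x: "x \<in> \<Gamma>" "nontangential K x z" "dist z x \<le> K * dist a b" for x
    proof -
      have "norm (cauchy_diff z x - cauchy_diff x x) \<le> C * dist z x powr \<sigma>"
        by (rule C(2)[OF x(1,2)])
      also have "\<dots> \<le> C * (K * dist a b) powr \<sigma>"
        using C(1) \<sigma> x(3) by (intro mult_left_mono powr_mono2) auto
      finally show ?thesis using K(1) by (simp add: powr_mult)
    qed
    have "z \<notin> \<Gamma>" using z(1) by (simp add: nontangential_def)
    have "norm (cauchy_diff z a - cauchy_diff z b) \<le> 2 * pi * norm (F a - F b)"
      using \<open>z \<notin> \<Gamma>\<close> by (rule norm_cauchy_diff_change_base_le)
    also have "\<dots> \<le> 2 * pi * (M * dist a b powr \<sigma>)" by (intro mult_left_mono M ab) simp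
    finally have change: "norm (cauchy_diff z a - cauchy_diff z b) \<le> 2 * pi * (M * dist a b powr \<sigma>)" .
    have "norm (cauchy_diff a a - cauchy_diff b b) \<le>
        norm (cauchy_diff z a - cauchy_diff a a) + norm (cauchy_diff z b - cauchy_diff b b)
        + norm (cauchy_diff z a - cauchy_diff z b)"
      by norm
    also have "\<dots> \<le> C * (K powr \<sigma> * dist a b powr \<sigma>) + C * (K powr \<sigma> * dist a b powr \<sigma>)
        + 2 * pi * (M * dist a b powr \<sigma>)"
      by (intro add_mono approach change ab z)
    finally show ?thesis by (simp add: algebra_simps)
  qed simp
  then show ?thesis unfolding holder_on_def by blast
qed

text \<open>Here \<open>n\<close> is the winding number on the side of the curve from which boundary values are taken.\<close>

definition cauchy_ext :: "complex \<Rightarrow> complex \<Rightarrow> complex" where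
  "cauchy_ext n z = (if z \<in> \<Gamma> then cauchy_diff z z / (2 * pi * \<i>) + F z * n else cauchy_int \<gamma> F z)"

lemma cauchy_ext_off_curve: "z \<notin> \<Gamma> \<Longrightarrow> cauchy_ext n z = cauchy_int \<gamma> F z"
  by (simp add: cauchy_ext_def)

lemma holder_on_cauchy_ext_curve: "holder_on \<sigma> \<Gamma> (cauchy_ext n)"
proof -
  have "holder_on \<sigma> \<Gamma> (\<lambda>z. 1 / (2 * pi * \<i>) * cauchy_diff z z + n * F z)"
    by (intro holder_on_add holder_on_cmult holder_on_cauchy_diff_diagonal holder)
  then show ?thesis by (simp add: cauchy_ext_def mult.commute cong: holder_on_cong)
qed

theorem holder_on_cauchy_ext:
  assumes \<Omega>: "\<And>z. z \<in> \<Omega> \<Longrightarrow> z \<notin> \<Gamma>" "\<And>z. z \<in> \<Omega> \<Longrightarrow> winding_number \<gamma> z = n"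
  shows "holder_on \<sigma> (\<Omega> \<union> \<Gamma>) (cauchy_ext n)"
proof -
  obtain A where A: "0 \<le> A" "\<And>a z. a \<in> \<Gamma> \<Longrightarrow> nontangential 1 a z \<Longrightarrow>
       norm (cauchy_diff z a - cauchy_diff a a) \<le> A * dist z a powr \<sigma>"
    using cauchy_diff_nontangential[of 1] by auto
  obtain B where B: "0 \<le> B" "\<And>z w. z \<notin> \<Gamma> \<Longrightarrow> 2 * dist z w \<le> infdist z \<Gamma> \<Longrightarrow>
       norm (cauchy_int \<gamma> F z - cauchy_int \<gamma> F w) \<le> B * dist z w powr \<sigma>"
    using cauchy_int_holder_interior by blast
  show ?thesis
  proof (rule holder_on_Un_closed
      [OF closed_path_image_curve path_image_nonempty _ holder_on_cauchy_ext_curve A(1) _ B(1)])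
    fix z a assume z: "z \<in> \<Omega>" and a: "a \<in> \<Gamma>" "infdist z \<Gamma> = dist z a"
    have "cauchy_ext n z - cauchy_ext n a = (cauchy_diff z a - cauchy_diff a a) / (2 * pi * \<i>)"
      using cauchy_int_eq_cauchy_diff[of z a] \<Omega>[OF z] a(1) by (simp add: cauchy_ext_def diff_divide_distrib)
    then have "norm (cauchy_ext n z - cauchy_ext n a) \<le> norm (cauchy_diff z a - cauchy_diff a a)"
      using norm_divide_2_pi_i_le by metis
    also have "\<dots> \<le> A * dist z a powr \<sigma>" using a \<Omega>[OF z] by (intro A(2)) (auto simp: nontangential_def)
    finally show "norm (cauchy_ext n z - cauchy_ext n a) \<le> A * dist z a powr \<sigma>" .
  qed (use \<sigma> B(2) \<Omega>(1) in \<open>auto simp: cauchy_ext_off_curve\<close>)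
qed

lemma holomorphic_on_cauchy_ext:
  assumes "\<Omega> \<inter> \<Gamma> = {}"
  shows "cauchy_ext n holomorphic_on \<Omega>"
proof -
  have "cauchy_int \<gamma> F holomorphic_on \<Omega>"
    using holomorphic_on_cauchy_int[OF continuous_density] assms by (blast intro: holomorphic_on_subset)
  then show ?thesis
    by (rule holomorphic_transform) (use assms in \<open>auto simp: cauchy_ext_off_curve disjoint_iff\<close>)
qed

lemma cauchy_ext_tendsto_0: "(cauchy_ext n \<longlongrightarrow> 0) at_infinity"
proof -
  obtain R where "\<And>\<zeta>. \<zeta> \<in> \<Gamma> \<Longrightarrow> norm \<zeta> < R"
    using bounded_simple_path_image[OF simple_path_curve] unfolding bounded_pos_less by blast
  then have "\<forall>\<^sub>F z in at_infinity. cauchy_int \<gamma> F z = cauchy_ext n z"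
    by (intro eventually_at_infinityI[of R] cauchy_ext_off_curve[symmetric]) force
  then show ?thesis
    using cauchy_int_tendsto_0[OF continuous_density] tendsto_cong by blast
qed

lemma plemelj_jump: "z \<in> \<Gamma> \<Longrightarrow> cauchy_ext 1 z - cauchy_ext 0 z = F z"
  by (simp add: cauchy_ext_def)

end

locale oriented_holder_density = holder_density +
  assumes winding_number_inside: "\<And>z. z \<in> inside \<Gamma> \<Longrightarrow> winding_number \<gamma> z = 1"
begin

lemma holder_on_cauchy_ext_inside: "holder_on \<sigma> (closure (inside \<Gamma>)) (cauchy_ext 1)"
  unfolding jordan by (rule holder_on_cauchy_ext) (use winding_number_inside not_in_path_image in auto)

lemma holder_on_cauchy_ext_outside: "holder_on \<sigma> (closure (outside \<Gamma>)) (cauchy_ext 0)"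
  unfolding jordan by (rule holder_on_cauchy_ext) (use winding_number_outside not_in_path_image in auto)

lemma hilbert_op_eq_cauchy_ext:
  assumes z: "z \<in> \<Gamma>"
  shows "hilbert_op \<gamma> F z = cauchy_ext 1 z"
proof -
  have "z \<in> closure (inside \<Gamma>)" using z jordan(1) by simp
  then have "(cauchy_ext 1 \<longlongrightarrow> cauchy_ext 1 z) (at z within inside \<Gamma>)"
    using holder_on_imp_continuous_on[OF holder_on_cauchy_ext_inside \<sigma>(1)]
    unfolding continuous_on_def by (meson tendsto_within_subset closure_subset)
  moreover have "\<forall>\<^sub>F w in at z within inside \<Gamma>. cauchy_ext 1 w = cauchy_int \<gamma> F w"
    by (simp add: eventually_at_filter cauchy_ext_off_curve not_in_path_image)
  ultimately have "(cauchy_int \<gamma> F \<longlongrightarrow> cauchy_ext 1 z) (at z within inside \<Gamma>)"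
    using tendsto_cong by blast
  moreover have "at z within inside \<Gamma> \<noteq> bot"
  proof -
    have "z \<notin> inside \<Gamma>" using z not_in_path_image by blast
    then show ?thesis
      using \<open>z \<in> closure (inside \<Gamma>)\<close> by (simp add: trivial_limit_within islimpt_in_closure)
  qed
  ultimately show ?thesis unfolding hilbert_op_def by (intro tendsto_Lim)
qed

theorem plemelj_decomposition:
  shows "hilbert_op \<gamma> F \<in> A_space \<sigma> \<Gamma>" "(\<lambda>z. F z - hilbert_op \<gamma> F z) \<in> A'_space \<sigma> \<Gamma>"
proof -
  have "cauchy_ext 1 holomorphic_on inside \<Gamma>" "cauchy_ext 0 holomorphic_on outside \<Gamma>"
    by (intro holomorphic_on_cauchy_ext inside_no_overlap outside_no_overlap)+
  then show "hilbert_op \<gamma> F \<in> A_space \<sigma> \<Gamma>"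
    unfolding A_space_def using holder_on_cauchy_ext_inside hilbert_op_eq_cauchy_ext by blast
  have "(\<lambda>z. - cauchy_ext 0 z) holomorphic_on outside \<Gamma>"
    using \<open>cauchy_ext 0 holomorphic_on outside \<Gamma>\<close> by (rule holomorphic_on_minus)
  moreover have "((\<lambda>z. - cauchy_ext 0 z) \<longlongrightarrow> 0) at_infinity"
    using tendsto_minus[OF cauchy_ext_tendsto_0] by simp
  moreover have "\<forall>z\<in>\<Gamma>. F z - hilbert_op \<gamma> F z = - cauchy_ext 0 z"
    using hilbert_op_eq_cauchy_ext plemelj_jump by (simp add: algebra_simps)
  ultimately show "(\<lambda>z. F z - hilbert_op \<gamma> F z) \<in> A'_space \<sigma> \<Gamma>"
    unfolding A'_space_def using holder_on_uminus[OF holder_on_cauchy_ext_outside] by blast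
qed

end

subsection \<open>Removability of analytic curves\<close>

lemma holomorphic_on_injective_image:
  assumes "open B" and G: "G holomorphic_on B" "inj_on G B" and h: "(\<lambda>u. h (G u)) holomorphic_on B"
  shows "h holomorphic_on G ` B"
proof -
  obtain g where g: "g holomorphic_on G ` B" "\<And>u. u \<in> B \<Longrightarrow> g (G u) = u"
    using holomorphic_has_inverse[OF G(1) \<open>open B\<close> G(2)] by metis
  have "g ` G ` B \<subseteq> B" using g(2) by auto
  then have "(\<lambda>z. h (G (g z))) holomorphic_on G ` B"
    using holomorphic_on_compose_gen[OF g(1) h] by (simp add: o_def)
  then show ?thesis
    by (rule holomorphic_transform) (use g(2) in auto)
qed

lemma analytic_jordan_curve_imp_regular:
  assumes "analytic_jordan_curve \<gamma>"
  shows "regular_jordan_curve \<gamma>"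
proof -
  obtain G S where G: "open S" "\<And>t. complex_of_real t \<in> S" "G holomorphic_on S"
      "\<And>t. \<gamma> t = G (complex_of_real t)" "\<And>t. deriv G (complex_of_real t) \<noteq> 0"
    using assms unfolding analytic_jordan_curve_def by blast
  have deriv: "(\<gamma> has_vector_derivative deriv G (of_real t)) (at t)" for t
  proof -
    have "((\<lambda>t. G (of_real t)) has_vector_derivative deriv G (of_real t)) (at t)"
      using holomorphic_derivI[OF G(3,1,2)] by (rule has_vector_derivative_real_field)
    moreover have "\<gamma> = (\<lambda>t. G (of_real t))" using G(4) by auto
    ultimately show ?thesis by simp
  qed
  have velocity: "vector_derivative \<gamma> (at t) = deriv G (of_real t)" for t
    using deriv by (rule vector_derivative_at)
  have "continuous_on UNIV (\<lambda>t. deriv G (complex_of_real t))"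
    by (rule continuous_on_compose2[OF holomorphic_on_imp_continuous_on[OF holomorphic_deriv[OF G(3,1)]]])
       (use G(2) in \<open>auto intro!: continuous_intros\<close>)
  moreover have "\<gamma> differentiable at t" for t
    using deriv[of t] unfolding has_vector_derivative_def by (rule differentiableI)
  ultimately show ?thesis
    using assms G(5) unfolding analytic_jordan_curve_def by unfold_locales (auto simp: velocity)
qed

context regular_jordan_curve
begin

lemma analytic_chart:
  assumes "analytic_jordan_curve \<gamma>" "p \<in> \<Gamma>"
  obtains B G where "open B" "G holomorphic_on B" "inj_on G B" "p \<in> G ` B"
    "\<And>u. u \<in> B \<Longrightarrow> G u \<in> \<Gamma> \<Longrightarrow> Im u = 0"
proof -
  obtain G S where G: "open S" "\<And>t. complex_of_real t \<in> S" "G holomorphic_on S"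
    and \<gamma>_G: "\<And>t. \<gamma> t = G (complex_of_real t)" and G_nz: "\<And>t. deriv G (complex_of_real t) \<noteq> 0"
    using assms(1) unfolding analytic_jordan_curve_def by blast
  obtain s where s: "s \<in> {0..1}" "p = \<gamma> s" using assms(2) by (rule path_imageE)
  obtain \<rho> where \<rho>: "0 < \<rho>" "ball (of_real s) \<rho> \<subseteq> S" "inj_on G (ball (of_real s) \<rho>)"
    using has_complex_derivative_locally_injective[OF G(3,2,1) G_nz] by blast
  obtain c where c: "0 < c" "\<And>s t. s \<in> {0..1} \<Longrightarrow> \<bar>t - s\<bar> \<le> 1/2 \<Longrightarrow> c * \<bar>t - s\<bar> \<le> norm (\<gamma> t - \<gamma> s)"
    using chord_arc by blast
  have "isCont G (of_real s)"
    using G holomorphic_on_imp_continuous_on continuous_on_eq_continuous_at by blast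
  then obtain \<delta> where \<delta>: "0 < \<delta>" "\<And>u. dist u (of_real s) < \<delta> \<Longrightarrow> dist (G u) (G (of_real s)) < c * \<rho>"
    unfolding continuous_at_eps_delta using c(1) \<rho>(1) by (metis mult_pos_pos)
  define B where "B = ball (complex_of_real s) (min \<rho> \<delta>)"
  have B: "B \<subseteq> ball (of_real s) \<rho>" by (auto simp: B_def)
  show thesis
  proof (rule that)
    show "open B" by (simp add: B_def)
    show "G holomorphic_on B" using G(3) B \<rho>(2) by (meson holomorphic_on_subset order_trans)
    show "inj_on G B" using \<rho>(3) B by (rule inj_on_subset)
    show "p \<in> G ` B" using \<rho>(1) \<delta>(1) by (auto simp: s(2) \<gamma>_G B_def)
    fix u assume u: "u \<in> B" "G u \<in> \<Gamma>"
    obtain t where t: "\<gamma> t = G u" "\<bar>t - s\<bar> \<le> 1/2"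
      using u(2) path_imageE nearest_parameter by metis
    have "c * \<bar>t - s\<bar> \<le> norm (G u - G (of_real s))" using c(2)[OF s(1) t(2)] t(1) \<gamma>_G by simp
    also have "\<dots> < c * \<rho>" using \<delta>(2)[of u] u(1) by (simp add: B_def dist_norm norm_minus_commute)
    finally have "\<bar>t - s\<bar> < \<rho>" using c(1) by simp
    then have "of_real t \<in> ball (complex_of_real s) \<rho>"
      by (simp add: dist_norm abs_minus_commute flip: of_real_diff)
    moreover have "G u = G (of_real t)" using t(1) \<gamma>_G by simp
    ultimately have "u = of_real t" using \<rho>(3) u(1) B by (meson inj_onD subsetD)
    then show "Im u = 0" by simp
  qed
qed

theorem analytic_curve_removable:
  assumes analytic: "analytic_jordan_curve \<gamma>"
    and cont: "continuous_on UNIV h" and hol: "h holomorphic_on - \<Gamma>"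
  shows "h holomorphic_on UNIV"
proof -
  have "h field_differentiable at p" for p
  proof (cases "p \<in> \<Gamma>")
    case False
    then show ?thesis
      using hol closed_path_image_curve by (simp add: holomorphic_on_imp_differentiable_at open_Compl)
  next
    case True
    obtain B G where B: "open B" "G holomorphic_on B" "inj_on G B" "p \<in> G ` B"
      and real: "\<And>u. u \<in> B \<Longrightarrow> G u \<in> \<Gamma> \<Longrightarrow> Im u = 0"
      using analytic_chart[OF analytic True] by blast
    have off_real: "(\<lambda>u. h (G u)) holomorphic_on T" if "T \<subseteq> B" "\<And>u. u \<in> T \<Longrightarrow> Im u \<noteq> 0" for T
      by (rule holomorphic_on_compose_gen[OF holomorphic_on_subset[OF B(2) that(1)] hol, unfolded o_def])
         (use real that in auto)
    have "(\<lambda>u. h (G u)) holomorphic_on B"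
    proof (rule holomorphic_on_paste_across_line[OF B(1), of \<i> _ 0])
      show "continuous_on B (\<lambda>u. h (G u))"
        by (rule continuous_on_compose2[OF cont holomorphic_on_imp_continuous_on[OF B(2)]]) auto
    qed (auto intro!: off_real simp: inner_complex_def)
    then have "h holomorphic_on G ` B" by (rule holomorphic_on_injective_image[OF B(1-3)])
    moreover have "open (G ` B)" by (rule open_mapping_thm3[OF B(2,1,3)])
    ultimately show ?thesis using B(4) holomorphic_on_imp_differentiable_at by blast
  qed
  then show ?thesis by (simp add: holomorphic_on_def)
qed

lemma glue_across_curve:
  assumes f: "continuous_on (closure (inside \<Gamma>)) f" "f holomorphic_on inside \<Gamma>"
    and g: "continuous_on (closure (outside \<Gamma>)) g" "g holomorphic_on outside \<Gamma>"
    and agree: "\<And>z. z \<in> \<Gamma> \<Longrightarrow> f z = g z"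
  obtains h where "continuous_on UNIV h" "h holomorphic_on - \<Gamma>"
    "\<And>z. z \<in> closure (inside \<Gamma>) \<Longrightarrow> h z = f z" "\<And>z. z \<in> closure (outside \<Gamma>) \<Longrightarrow> h z = g z"
proof -
  have common_boundary: "z \<in> \<Gamma>" if "z \<in> closure (inside \<Gamma>)" "z \<in> closure (outside \<Gamma>)" for z
    using that jordan(1,2) inside_Int_outside[of \<Gamma>] by blast
  define h where "h = (\<lambda>z. if z \<in> closure (inside \<Gamma>) then f z else g z)"
  have h_f: "h z = f z" if "z \<in> closure (inside \<Gamma>)" for z using that by (simp add: h_def)
  have h_g: "h z = g z" if "z \<in> closure (outside \<Gamma>)" for z
    using that common_boundary agree by (auto simp: h_def)
  have "continuous_on (closure (inside \<Gamma>) \<union> closure (outside \<Gamma>)) h"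
    unfolding h_def using f(1) g(1) common_boundary agree by (intro continuous_on_If) auto
  moreover have "closure (inside \<Gamma>) \<union> closure (outside \<Gamma>) = UNIV"
    using jordan(1,2) inside_Un_outside[of \<Gamma>] by blast
  ultimately have continuous: "continuous_on UNIV h" by simp
  have "h holomorphic_on inside \<Gamma>" "h holomorphic_on outside \<Gamma>"
    using f(2) g(2) closure_subset h_f h_g by (force elim!: holomorphic_transform)+
  then have "h holomorphic_on - \<Gamma>"
    using holomorphic_on_Un[OF _ _ jordan(3,4)] inside_Un_outside[of \<Gamma>] by simp
  with continuous show thesis by (rule that[OF _ _ h_f h_g])
qed

theorem analytic_curve_glue_eq_0:
  assumes analytic: "analytic_jordan_curve \<gamma>"
    and f: "continuous_on (closure (inside \<Gamma>)) f" "f holomorphic_on inside \<Gamma>"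
    and g: "continuous_on (closure (outside \<Gamma>)) g" "g holomorphic_on outside \<Gamma>" "(g \<longlongrightarrow> 0) at_infinity"
    and agree: "\<And>z. z \<in> \<Gamma> \<Longrightarrow> f z = g z" and z: "z \<in> \<Gamma>"
  shows "f z = 0"
proof -
  obtain h where h: "continuous_on UNIV h" "h holomorphic_on - \<Gamma>"
    and h_f: "\<And>z. z \<in> closure (inside \<Gamma>) \<Longrightarrow> h z = f z" and h_g: "\<And>z. z \<in> closure (outside \<Gamma>) \<Longrightarrow> h z = g z"
    using glue_across_curve[OF f g(1,2) agree] by blast
  have "h holomorphic_on UNIV" using analytic h by (rule analytic_curve_removable)
  moreover have "(h \<longlongrightarrow> 0) at_infinity"
  proof -
    obtain R where R: "\<And>z. z \<in> inside \<Gamma> \<union> \<Gamma> \<Longrightarrow> norm z < R"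
      using bounded_closure[OF jordan(5)] unfolding jordan bounded_pos_less by blast
    have "g z = h z" if "R \<le> norm z" for z
    proof -
      have "z \<notin> inside \<Gamma> \<union> \<Gamma>" using R that by (meson not_le)
      then have "z \<in> closure (outside \<Gamma>)" using inside_Un_outside[of \<Gamma>] closure_subset by blast
      then show ?thesis by (simp add: h_g)
    qed
    then have "\<forall>\<^sub>F z in at_infinity. g z = h z" by (rule eventually_at_infinityI)
    then show ?thesis using g(3) tendsto_cong by blast
  qed
  ultimately have "h z = 0" by (rule Liouville_weak_0)
  then show ?thesis using h_f z jordan(1) by simp
qed

end

subsection \<open>The projection onto the interior functions\<close>

lemma A_space_cong: "f \<in> A_space \<sigma> \<Gamma> \<Longrightarrow> (\<And>z. z \<in> \<Gamma> \<Longrightarrow> f' z = f z) \<Longrightarrow> f' \<in> A_space \<sigma> \<Gamma>"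
  unfolding A_space_def by auto

lemma A'_space_cong: "g \<in> A'_space \<sigma> \<Gamma> \<Longrightarrow> (\<And>z. z \<in> \<Gamma> \<Longrightarrow> g' z = g z) \<Longrightarrow> g' \<in> A'_space \<sigma> \<Gamma>"
  unfolding A'_space_def by auto

lemma const_in_A_space: "(\<lambda>z. c) \<in> A_space \<sigma> \<Gamma>"
  unfolding A_space_def using holder_on_const by (auto intro!: exI[of _ "\<lambda>z. c"])

lemma A_space_diff:
  assumes "f \<in> A_space \<sigma> \<Gamma>" "g \<in> A_space \<sigma> \<Gamma>"
  shows "(\<lambda>z. f z - g z) \<in> A_space \<sigma> \<Gamma>"
proof -
  obtain u v where u: "holder_on \<sigma> (closure (inside \<Gamma>)) u" "u holomorphic_on inside \<Gamma>" "\<forall>z\<in>\<Gamma>. f z = u z"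
    and v: "holder_on \<sigma> (closure (inside \<Gamma>)) v" "v holomorphic_on inside \<Gamma>" "\<forall>z\<in>\<Gamma>. g z = v z"
    using assms unfolding A_space_def by blast
  show ?thesis unfolding A_space_def
    using u(3) v(3) holder_on_diff[OF u(1) v(1)] holomorphic_on_diff[OF u(2) v(2)]
    by (intro CollectI exI[of _ "\<lambda>z. u z - v z"]) auto
qed

lemma A'_space_diff:
  assumes "f \<in> A'_space \<sigma> \<Gamma>" "g \<in> A'_space \<sigma> \<Gamma>"
  shows "(\<lambda>z. f z - g z) \<in> A'_space \<sigma> \<Gamma>"
proof -
  obtain u v where
    u: "holder_on \<sigma> (closure (outside \<Gamma>)) u" "u holomorphic_on outside \<Gamma>" "(u \<longlongrightarrow> 0) at_infinity"
      "\<forall>z\<in>\<Gamma>. f z = u z"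
    and v: "holder_on \<sigma> (closure (outside \<Gamma>)) v" "v holomorphic_on outside \<Gamma>" "(v \<longlongrightarrow> 0) at_infinity"
      "\<forall>z\<in>\<Gamma>. g z = v z"
    using assms unfolding A'_space_def by blast
  show ?thesis unfolding A'_space_def
    using u(4) v(4) holder_on_diff[OF u(1) v(1)] holomorphic_on_diff[OF u(2) v(2)] tendsto_diff[OF u(3) v(3)]
    by (intro CollectI exI[of _ "\<lambda>z. u z - v z"]) auto
qed

lemma Lambda_sigma_conj_op: "F \<in> Lambda_sigma \<sigma> \<Gamma> \<Longrightarrow> conj_op F \<in> Lambda_sigma \<sigma> \<Gamma>"
  unfolding Lambda_sigma_def conj_op_def by (simp add: holder_on_cnj)

lemma conj_op_constant_on_iff: "conj_op f constant_on S \<longleftrightarrow> f constant_on S"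
  unfolding constant_on_def conj_op_def by (metis complex_cnj_cnj)

locale oriented_analytic_curve =
  fixes \<gamma> :: "real \<Rightarrow> complex" and \<sigma> :: real
  assumes analytic: "analytic_jordan_curve \<gamma>"
    and winding_number_inside: "\<And>z. z \<in> inside (path_image \<gamma>) \<Longrightarrow> winding_number \<gamma> z = 1"
    and \<sigma>: "0 < \<sigma>" "\<sigma> < 1"
begin

sublocale regular_jordan_curve \<gamma>
  using analytic by (rule analytic_jordan_curve_imp_regular)

lemma A_space_subset_Lambda_sigma: "A_space \<sigma> \<Gamma> \<subseteq> Lambda_sigma \<sigma> \<Gamma>"
proof -
  have "\<Gamma> \<subseteq> closure (inside \<Gamma>)" using jordan(1) by blast
  then show ?thesis
    unfolding A_space_def Lambda_sigma_def using holder_on_subset by (auto cong: holder_on_cong)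
qed

lemma A'_space_subset_Lambda_sigma: "A'_space \<sigma> \<Gamma> \<subseteq> Lambda_sigma \<sigma> \<Gamma>"
proof -
  have "\<Gamma> \<subseteq> closure (outside \<Gamma>)" using jordan(2) by blast
  then show ?thesis
    unfolding A'_space_def Lambda_sigma_def using holder_on_subset by (auto cong: holder_on_cong)
qed

lemma A_space_Int_A'_space_eq_0:
  assumes "F \<in> A_space \<sigma> \<Gamma>" "F \<in> A'_space \<sigma> \<Gamma>" "z \<in> \<Gamma>"
  shows "F z = 0"
proof -
  obtain f where f: "holder_on \<sigma> (closure (inside \<Gamma>)) f" "f holomorphic_on inside \<Gamma>" "\<forall>z\<in>\<Gamma>. F z = f z"
    using assms(1) unfolding A_space_def by blast
  obtain g where g: "holder_on \<sigma> (closure (outside \<Gamma>)) g" "g holomorphic_on outside \<Gamma>" "(g \<longlongrightarrow> 0) at_infinity"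
    "\<forall>z\<in>\<Gamma>. F z = g z"
    using assms(2) unfolding A'_space_def by blast
  have "f z = 0"
    by (rule analytic_curve_glue_eq_0[OF analytic, of f g])
       (use f g assms(3) \<sigma>(1) in \<open>auto intro: holder_on_imp_continuous_on\<close>)
  then show ?thesis using f(3) assms(3) by simp
qed

lemma
  assumes "F \<in> Lambda_sigma \<sigma> \<Gamma>"
  shows hilbert_op_in_A_space: "hilbert_op \<gamma> F \<in> A_space \<sigma> \<Gamma>"
    and diff_hilbert_op_in_A'_space: "(\<lambda>z. F z - hilbert_op \<gamma> F z) \<in> A'_space \<sigma> \<Gamma>"
proof -
  interpret oriented_holder_density \<gamma> F \<sigma>
    using assms \<sigma> winding_number_inside by unfold_locales (auto simp: Lambda_sigma_def)
  show "hilbert_op \<gamma> F \<in> A_space \<sigma> \<Gamma>" "(\<lambda>z. F z - hilbert_op \<gamma> F z) \<in> A'_space \<sigma> \<Gamma>"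
    by (fact plemelj_decomposition)+
qed

lemma hilbert_op_A_space:
  assumes "F \<in> A_space \<sigma> \<Gamma>" "z \<in> \<Gamma>"
  shows "hilbert_op \<gamma> F z = F z"
proof -
  have F: "F \<in> Lambda_sigma \<sigma> \<Gamma>" using assms(1) A_space_subset_Lambda_sigma by blast
  have "(\<lambda>z. F z - hilbert_op \<gamma> F z) \<in> A_space \<sigma> \<Gamma>"
    by (rule A_space_diff[OF assms(1) hilbert_op_in_A_space[OF F]])
  from A_space_Int_A'_space_eq_0[OF this diff_hilbert_op_in_A'_space[OF F] assms(2)]
  show ?thesis by simp
qed

lemma hilbert_op_A'_space:
  assumes "F \<in> A'_space \<sigma> \<Gamma>" "z \<in> \<Gamma>"
  shows "hilbert_op \<gamma> F z = 0"
proof -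
  have F: "F \<in> Lambda_sigma \<sigma> \<Gamma>" using assms(1) A'_space_subset_Lambda_sigma by blast
  have "hilbert_op \<gamma> F \<in> A'_space \<sigma> \<Gamma>"
    using A'_space_diff[OF assms(1) diff_hilbert_op_in_A'_space[OF F]] by simp
  from A_space_Int_A'_space_eq_0[OF hilbert_op_in_A_space[OF F] this assms(2)] show ?thesis .
qed

subsection \<open>Fixed points of \<open>\<Pi>\<close>\<close>

lemma
  assumes f: "f \<in> A_space \<sigma> \<Gamma>" and g: "g \<in> A'_space \<sigma> \<Gamma>"
    and f_g: "\<And>z. z \<in> \<Gamma> \<Longrightarrow> f z = cnj (g z)" and z: "z \<in> \<Gamma>"
  shows Pi_op_interior_fixed: "Pi_op \<gamma> f z = f z"
    and Pi_op_exterior_fixed: "Pi_op \<gamma> g z = g z"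
proof -
  have "conj_op f \<in> A'_space \<sigma> \<Gamma>" by (rule A'_space_cong[OF g]) (simp add: conj_op_def f_g)
  from hilbert_op_A'_space[OF this z] show "Pi_op \<gamma> f z = f z"
    using hilbert_op_A_space[OF f z] by (simp add: Pi_op_def conj_op_def)
  have "conj_op g \<in> A_space \<sigma> \<Gamma>" by (rule A_space_cong[OF f]) (simp add: conj_op_def f_g)
  from hilbert_op_A_space[OF this z] show "Pi_op \<gamma> g z = g z"
    using hilbert_op_A'_space[OF g z] by (simp add: Pi_op_def conj_op_def)
qed

lemma conj_op_in_A'_space_not_constant_on:
  assumes "conj_op f \<in> A'_space \<sigma> \<Gamma>" "z \<in> \<Gamma>" "f z \<noteq> 0"
  shows "\<not> f constant_on \<Gamma>"
proof
  assume "f constant_on \<Gamma>"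
  then obtain c where "\<And>z. z \<in> \<Gamma> \<Longrightarrow> f z = c" unfolding constant_on_def by blast
  then have "conj_op f \<in> A_space \<sigma> \<Gamma>"
    by (intro A_space_cong[OF const_in_A_space[of "cnj c"]]) (simp add: conj_op_def)
  then have "conj_op f z = 0" using assms by (intro A_space_Int_A'_space_eq_0)
  then show False using assms(3) by (simp add: conj_op_def)
qed

lemma Pi_op_fixed_point_imp_conj_in_A'_space:
  assumes F: "F \<in> Lambda_sigma \<sigma> \<Gamma>" and fixed: "\<And>z. z \<in> \<Gamma> \<Longrightarrow> Pi_op \<gamma> F z = F z"
    and z: "z \<in> \<Gamma>" "F z \<noteq> 0"
  obtains f where "f \<in> A_space \<sigma> \<Gamma>" "conj_op f \<in> A'_space \<sigma> \<Gamma>" "\<not> f constant_on \<Gamma>"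
proof -
  define f k where "f = hilbert_op \<gamma> F" and "k = hilbert_op \<gamma> (conj_op F)"
  have F_eq: "F z = f z + cnj (k z)" if "z \<in> \<Gamma>" for z
    using fixed[OF that] by (simp add: Pi_op_def conj_op_def f_def k_def)
  have f: "f \<in> A_space \<sigma> \<Gamma>" "(\<lambda>z. F z - f z) \<in> A'_space \<sigma> \<Gamma>"
    unfolding f_def using F by (rule hilbert_op_in_A_space diff_hilbert_op_in_A'_space)+
  have k: "k \<in> A_space \<sigma> \<Gamma>" "(\<lambda>z. conj_op F z - k z) \<in> A'_space \<sigma> \<Gamma>"
    unfolding k_def using Lambda_sigma_conj_op[OF F]
    by (rule hilbert_op_in_A_space diff_hilbert_op_in_A'_space)+
  have "conj_op f \<in> A'_space \<sigma> \<Gamma>" by (rule A'_space_cong[OF k(2)]) (simp add: conj_op_def F_eq)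
  moreover have "conj_op k \<in> A'_space \<sigma> \<Gamma>" by (rule A'_space_cong[OF f(2)]) (simp add: conj_op_def F_eq)
  moreover have "f z \<noteq> 0 \<or> k z \<noteq> 0" using F_eq[OF z(1)] z(2) by auto
  ultimately show thesis
    using that f(1) k(1) conj_op_in_A'_space_not_constant_on[OF _ z(1)] by blast
qed

end

theorem theorem1p20:
  fixes \<sigma> :: real and \<gamma> :: "real \<Rightarrow> complex"
  assumes "0 < \<sigma>" and "\<sigma> < 1"
    and "analytic_jordan_curve \<gamma>"
    and "\<forall>z\<in>inside (path_image \<gamma>). winding_number \<gamma> z = 1"
  shows "((\<exists>F\<in>Lambda_sigma \<sigma> (path_image \<gamma>).
             (\<forall>z\<in>path_image \<gamma>. Pi_op \<gamma> F z = F z) \<and> (\<exists>z\<in>path_image \<gamma>. F z \<noteq> 0))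
          \<longleftrightarrow>
          (\<exists>f\<in>A_space \<sigma> (path_image \<gamma>). \<exists>g\<in>A'_space \<sigma> (path_image \<gamma>).
             \<not> (\<exists>c. \<forall>z\<in>path_image \<gamma>. f z = c) \<and> \<not> (\<exists>c. \<forall>z\<in>path_image \<gamma>. g z = c) \<and>
             (\<forall>z\<in>path_image \<gamma>. f z = cnj (g z))))
       \<and> (\<forall>f\<in>A_space \<sigma> (path_image \<gamma>). \<forall>g\<in>A'_space \<sigma> (path_image \<gamma>).
             \<not> (\<exists>c. \<forall>z\<in>path_image \<gamma>. f z = c) \<and> \<not> (\<exists>c. \<forall>z\<in>path_image \<gamma>. g z = c) \<and>
             (\<forall>z\<in>path_image \<gamma>. f z = cnj (g z)) \<longrightarrow>
             (\<forall>z\<in>path_image \<gamma>. Pi_op \<gamma> f z = f z) \<and> (\<forall>z\<in>path_image \<gamma>. Pi_op \<gamma> g z = g z))"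
  unfolding constant_on_def[symmetric]
proof (intro conjI iffI)
  interpret oriented_analytic_curve \<gamma> \<sigma>
    using assms by unfold_locales auto
  show "\<forall>f\<in>A_space \<sigma> \<Gamma>. \<forall>g\<in>A'_space \<sigma> \<Gamma>. \<not> f constant_on \<Gamma> \<and> \<not> g constant_on \<Gamma> \<and> (\<forall>z\<in>\<Gamma>. f z = cnj (g z)) \<longrightarrow>
      (\<forall>z\<in>\<Gamma>. Pi_op \<gamma> f z = f z) \<and> (\<forall>z\<in>\<Gamma>. Pi_op \<gamma> g z = g z)"
    using Pi_op_interior_fixed Pi_op_exterior_fixed by blast
  show "\<exists>f\<in>A_space \<sigma> \<Gamma>. \<exists>g\<in>A'_space \<sigma> \<Gamma>. \<not> f constant_on \<Gamma> \<and> \<not> g constant_on \<Gamma> \<and> (\<forall>z\<in>\<Gamma>. f z = cnj (g z))"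
    if fixed_point: "\<exists>F\<in>Lambda_sigma \<sigma> \<Gamma>. (\<forall>z\<in>\<Gamma>. Pi_op \<gamma> F z = F z) \<and> (\<exists>z\<in>\<Gamma>. F z \<noteq> 0)"
  proof -
    obtain f where f: "f \<in> A_space \<sigma> \<Gamma>" "conj_op f \<in> A'_space \<sigma> \<Gamma>" "\<not> f constant_on \<Gamma>"
      using fixed_point Pi_op_fixed_point_imp_conj_in_A'_space by blast
    then have "\<not> conj_op f constant_on \<Gamma>" by (simp add: conj_op_constant_on_iff)
    with f show ?thesis by (intro bexI[of _ f] bexI[of _ "conj_op f"]) (auto simp: conj_op_def)
  qed
  show "\<exists>F\<in>Lambda_sigma \<sigma> \<Gamma>. (\<forall>z\<in>\<Gamma>. Pi_op \<gamma> F z = F z) \<and> (\<exists>z\<in>\<Gamma>. F z \<noteq> 0)"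
    if pair: "\<exists>f\<in>A_space \<sigma> \<Gamma>. \<exists>g\<in>A'_space \<sigma> \<Gamma>. \<not> f constant_on \<Gamma> \<and> \<not> g constant_on \<Gamma> \<and> (\<forall>z\<in>\<Gamma>. f z = cnj (g z))"
    using pair Pi_op_interior_fixed A_space_subset_Lambda_sigma unfolding constant_on_def by blast
qed

end
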